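(* An F-quasigroup $(Q,\cdot)$ is simple if and only if $(Q,\cdot)$ lies in one of the following quasigroup classes: (i) $(Q,\cdot)$ is a simple group, in the case when the maps $e$ and $f$ are zero endomorphisms; (ii) $(Q,\cdot)$ has the form $x\cdot y=x+\psi y$, where $(Q,+)$ is a $\psi$-simple abelian group and $\psi\in\mathrm{Aut}(Q,+)$, in the case when $e$ is a zero endomorphism and $f$ is a permutation; in this case $e(x)=0$ and $fx+\psi x=x$ for all $x\in Q$; (iii) $(Q,\cdot)$ has the form $x\cdot y=\varphi x+y$, where $(Q,+)$ is a $\varphi$-simple abelian group and $\varphi\in\mathrm{Aut}(Q,+)$, in the case when $f$ is a zero endomorphism and $e$ is a permutation; in this case $f(x)=0$ and $\varphi x+ex=x$ for all $x\in Q$; (iv) $(Q,\cdot)$ has the form $x\cdot y=x\circ\psi y$, where $(Q,\circ)$ is a $\psi$-simple distributive quasigroup and $\psi\in\mathrm{Aut}(Q,\circ)$, in the case when $e$ and $f$ are permutations; in this case $e=\psi^{-1}$ and $fx\circ\psi x=x$ for all $x\in Q$.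
   Context: A quasigroup $(Q,\cdot)$ is a set with a binary operation such that for all $a,b\in Q$ the equations $a\cdot x=b$ and $y\cdot a=b$ have unique solutions. Juxtaposition binds more tightly than the dot. The maps $e,f$ are defined by $x\cdot e(x)=x$ and $f(x)\cdot x=x$. An F-quasigroup is a quasigroup satisfying both $x\cdot yz=xy\cdot e(x)z$ and $xy\cdot z=xf(z)\cdot yz$ for all $x,y,z$ (in it $e$ and $f$ are endomorphisms). A zero endomorphism is a constant one; "permutation" means bijection of the set $Q$. A quasigroup is distributive if $x\cdot uv=xu\cdot xv$ and $xu\cdot v=xv\cdot uv$ for all $x,u,v$. A congruence $\theta$ of a quasigroup is an equivalence relation such that $x\,\theta\,y$ implies $(zx)\,\theta\,(zy)$ and $(xz)\,\theta\,(yz)$; it is normal if also $(zx)\,\theta\,(zy)$ implies $x\,\theta\,y$ and $(xz)\,\theta\,(yz)$ implies $x\,\theta\,y$. A quasigroup is simple if its only normal congruences are the diagonal and the universal relation. A permutation $\alpha$ of $Q$ is admissible relative to $\theta$ if $x\,\theta\,y$ implies $\alpha x\,\theta\,\alpha y$ and $\alpha^{-1}x\,\theta\,\alpha^{-1}y$. A quasigroup on $Q$ (in particular a group) is $\alpha$-simple if the diagonal and the universal relation are its only normal congruences relative to which $\alpha$ is admissible. "Has the form" means that a structure $(Q,+)$ or $(Q,\circ)$ as described exists on the set $Q$; $0$ is the identity of $(Q,+)$. *)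

theory Defs
  imports "HOL-Algebra.Coset"
begin

text \<open>
  The underlying set \<open>Q\<close> is an arbitrary type \<open>'a\<close>, so \<open>Q\<close> is nonempty; a binary operation on
  \<open>Q\<close> is a function \<open>'a \<Rightarrow> 'a \<Rightarrow> 'a\<close>. Several operations may live on the same \<open>Q\<close>, hence explicit
  operations rather than type classes.
\<close>

definition quasigroup :: "('a \<Rightarrow> 'a \<Rightarrow> 'a) \<Rightarrow> bool" where
  "quasigroup m \<longleftrightarrow> (\<forall>a b. \<exists>!x. m a x = b) \<and> (\<forall>a b. \<exists>!y. m y a = b)"

definition e_map :: "('a \<Rightarrow> 'a \<Rightarrow> 'a) \<Rightarrow> 'a \<Rightarrow> 'a" where
  "e_map m x = (THE u. m x u = x)"

definition f_map :: "('a \<Rightarrow> 'a \<Rightarrow> 'a) \<Rightarrow> 'a \<Rightarrow> 'a" where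
  "f_map m x = (THE u. m u x = x)"

definition F_quasigroup :: "('a \<Rightarrow> 'a \<Rightarrow> 'a) \<Rightarrow> bool" where
  "F_quasigroup m \<longleftrightarrow> quasigroup m \<and>
     (\<forall>x y z. m x (m y z) = m (m x y) (m (e_map m x) z)) \<and>
     (\<forall>x y z. m (m x y) z = m (m x (f_map m z)) (m y z))"

definition distributive_quasigroup :: "('a \<Rightarrow> 'a \<Rightarrow> 'a) \<Rightarrow> bool" where
  "distributive_quasigroup m \<longleftrightarrow> quasigroup m \<and>
     (\<forall>x u v. m x (m u v) = m (m x u) (m x v)) \<and>
     (\<forall>x u v. m (m x u) v = m (m x v) (m u v))"

definition endomorphism :: "('a \<Rightarrow> 'a \<Rightarrow> 'a) \<Rightarrow> ('a \<Rightarrow> 'a) \<Rightarrow> bool" where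
  "endomorphism m h \<longleftrightarrow> (\<forall>x y. h (m x y) = m (h x) (h y))"

definition automorphism :: "('a \<Rightarrow> 'a \<Rightarrow> 'a) \<Rightarrow> ('a \<Rightarrow> 'a) \<Rightarrow> bool" where
  "automorphism m h \<longleftrightarrow> endomorphism m h \<and> bij h"

definition zero_endomorphism :: "('a \<Rightarrow> 'a \<Rightarrow> 'a) \<Rightarrow> ('a \<Rightarrow> 'a) \<Rightarrow> bool" where
  "zero_endomorphism m h \<longleftrightarrow> endomorphism m h \<and> (\<exists>c. \<forall>x. h x = c)"

definition congruence :: "('a \<Rightarrow> 'a \<Rightarrow> 'a) \<Rightarrow> ('a \<times> 'a) set \<Rightarrow> bool" where
  "congruence m \<theta> \<longleftrightarrow> equiv UNIV \<theta> \<and>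
     (\<forall>x y z. (x, y) \<in> \<theta> \<longrightarrow> (m z x, m z y) \<in> \<theta> \<and> (m x z, m y z) \<in> \<theta>)"

definition normal_congruence :: "('a \<Rightarrow> 'a \<Rightarrow> 'a) \<Rightarrow> ('a \<times> 'a) set \<Rightarrow> bool" where
  "normal_congruence m \<theta> \<longleftrightarrow> congruence m \<theta> \<and>
     (\<forall>x y z. (m z x, m z y) \<in> \<theta> \<longrightarrow> (x, y) \<in> \<theta>) \<and>
     (\<forall>x y z. (m x z, m y z) \<in> \<theta> \<longrightarrow> (x, y) \<in> \<theta>)"

definition simple_quasigroup :: "('a \<Rightarrow> 'a \<Rightarrow> 'a) \<Rightarrow> bool" where
  "simple_quasigroup m \<longleftrightarrow> quasigroup m \<and>
     (\<forall>\<theta>. normal_congruence m \<theta> \<longrightarrow> \<theta> = Id \<or> \<theta> = UNIV)"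

text \<open>Admissibility is only meaningful for a permutation \<open>\<alpha>\<close>; \<open>alpha_simple\<close> requires it.\<close>

definition admissible :: "('a \<Rightarrow> 'a) \<Rightarrow> ('a \<times> 'a) set \<Rightarrow> bool" where
  "admissible \<alpha> \<theta> \<longleftrightarrow> (\<forall>x y. (x, y) \<in> \<theta> \<longrightarrow> (\<alpha> x, \<alpha> y) \<in> \<theta> \<and> (inv_into UNIV \<alpha> x, inv_into UNIV \<alpha> y) \<in> \<theta>)"

definition alpha_simple :: "('a \<Rightarrow> 'a) \<Rightarrow> ('a \<Rightarrow> 'a \<Rightarrow> 'a) \<Rightarrow> bool" where
  "alpha_simple \<alpha> m \<longleftrightarrow> quasigroup m \<and> bij \<alpha> \<and>
     (\<forall>\<theta>. normal_congruence m \<theta> \<and> admissible \<alpha> \<theta> \<longrightarrow> \<theta> = Id \<or> \<theta> = UNIV)"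

abbreviation on_UNIV :: "('a \<Rightarrow> 'a \<Rightarrow> 'a) \<Rightarrow> 'a \<Rightarrow> 'a monoid" where
  "on_UNIV m u \<equiv> \<lparr>carrier = UNIV, monoid.mult = m, one = u\<rparr>"

text \<open>
  Simplicity of a group is simplicity as a quasigroup; the one-element group counts as simple.
  The locale \<open>simple_group\<close> of HOL-Algebra demands \<open>order G > 1\<close>, which excludes the trivial group
  and, \<open>card\<close> of an infinite set being \<open>0\<close>, every infinite group. The lemma
  \<open>simple_group_on_iff_normal\<close> below relates the definition to normal subgroups.
\<close>

definition simple_group_on :: "('a \<Rightarrow> 'a \<Rightarrow> 'a) \<Rightarrow> bool" where
  "simple_group_on m \<longleftrightarrow> (\<exists>u. group (on_UNIV m u)) \<and> simple_quasigroup m"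

definition sum_right_form ::
  "('a \<Rightarrow> 'a \<Rightarrow> 'a) \<Rightarrow> ('a \<Rightarrow> 'a \<Rightarrow> 'a) \<Rightarrow> 'a \<Rightarrow> ('a \<Rightarrow> 'a) \<Rightarrow> bool" where
  "sum_right_form m add zero \<psi> \<longleftrightarrow>
     comm_group (on_UNIV add zero) \<and> alpha_simple \<psi> add \<and> automorphism add \<psi> \<and>
     (\<forall>x y. m x y = add x (\<psi> y))"

definition sum_left_form ::
  "('a \<Rightarrow> 'a \<Rightarrow> 'a) \<Rightarrow> ('a \<Rightarrow> 'a \<Rightarrow> 'a) \<Rightarrow> 'a \<Rightarrow> ('a \<Rightarrow> 'a) \<Rightarrow> bool" where
  "sum_left_form m add zero \<phi> \<longleftrightarrow>
     comm_group (on_UNIV add zero) \<and> alpha_simple \<phi> add \<and> automorphism add \<phi> \<and>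
     (\<forall>x y. m x y = add (\<phi> x) y)"

definition distributive_form ::
  "('a \<Rightarrow> 'a \<Rightarrow> 'a) \<Rightarrow> ('a \<Rightarrow> 'a \<Rightarrow> 'a) \<Rightarrow> ('a \<Rightarrow> 'a) \<Rightarrow> bool" where
  "distributive_form m d \<psi> \<longleftrightarrow>
     distributive_quasigroup d \<and> alpha_simple \<psi> d \<and> automorphism d \<psi> \<and>
     (\<forall>x y. m x y = d x (\<psi> y))"

lemma e_map_unique:
  assumes "quasigroup m"
  shows "m x u = x \<longleftrightarrow> u = e_map m x"
proof -
  have "\<exists>!u. m x u = x" using assms by (simp add: quasigroup_def)
  from theI'[OF this] this show ?thesis unfolding e_map_def by blast
qed

lemma f_map_unique:
  assumes "quasigroup m"
  shows "m u x = x \<longleftrightarrow> u = f_map m x"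
proof -
  have "\<exists>!u. m u x = x" using assms by (simp add: quasigroup_def)
  from theI'[OF this] this show ?thesis unfolding f_map_def by blast
qed

lemma group_imp_quasigroup:
  assumes "group (on_UNIV m u)"
  shows "quasigroup m"
proof -
  interpret group "on_UNIV m u" by fact
  let ?i = "m_inv (on_UNIV m u)"
  have as: "m (m x y) z = m x (m y z)" for x y z using m_assoc[of x y z] by simp
  have l: "m (?i x) x = u" "m x (?i x) = u" "m u x = x" "m x u = x" for x
    using l_inv[of x] r_inv[of x] l_one[of x] r_one[of x] by simp_all
  have c: "m (?i x) (m x y) = y" "m x (m (?i x) y) = y" for x y
    by (simp_all add: as[symmetric] l)
  have "\<exists>!x. m a x = b" for a b
    by (rule ex1I[of _ "m (?i a) b"]) (auto simp: c)
  moreover have "\<exists>!y. m y a = b" for a b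
    by (rule ex1I[of _ "m b (?i a)"]) (auto simp: as l)
  ultimately show ?thesis unfolding quasigroup_def by blast
qed

lemma simple_group_on_iff_normal:
  assumes G: "group (on_UNIV m u)"
  shows "simple_group_on m \<longleftrightarrow> (\<forall>H. H \<lhd> on_UNIV m u \<longrightarrow> H = UNIV \<or> H = {u})"
proof -
  interpret group "on_UNIV m u" by fact
  let ?G = "on_UNIV m u" let ?i = "m_inv (on_UNIV m u)"
  have as: "m (m x y) z = m x (m y z)" for x y z using m_assoc[of x y z] by simp
  have l: "m (?i x) x = u" "m x (?i x) = u" "m u x = x" "m x u = x" for x
    using l_inv[of x] r_inv[of x] l_one[of x] r_one[of x] by simp_all
  have im: "?i (m x y) = m (?i y) (?i x)" for x y using inv_mult_group[of x y] by simp
  have ii: "?i (?i x) = x" for x using inv_inv[of x] by simp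
  have c: "m (?i x) (m x y) = y" "m x (m (?i x) y) = y" for x y
    by (simp_all add: as[symmetric] l)
  show ?thesis
  proof
    assume S: "simple_group_on m"
    show "\<forall>H. H \<lhd> ?G \<longrightarrow> H = UNIV \<or> H = {u}"
    proof (intro allI impI)
      fix H assume H: "H \<lhd> ?G"
      interpret H: normal H ?G by fact
      have H1: "u \<in> H" using H.one_closed by simp
      have Hm: "x \<in> H \<Longrightarrow> y \<in> H \<Longrightarrow> m x y \<in> H" for x y using H.m_closed by simp
      have Hi: "x \<in> H \<Longrightarrow> ?i x \<in> H" for x using H.m_inv_closed by simp
      have Hn: "h \<in> H \<Longrightarrow> m (m x h) (?i x) \<in> H" for x h using H.inv_op_closed2[of x h] by simp
      have Hn': "m (m x h) (?i x) \<in> H \<longleftrightarrow> h \<in> H" for x h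
        using Hn[of h x] Hn[of "m (m x h) (?i x)" "?i x"] by (auto simp: as ii c l)
      define \<theta> where "\<theta> = {(x, y). m x (?i y) \<in> H}"
      have "equiv UNIV \<theta>"
      proof (rule equivI)
        show "refl_on UNIV \<theta>" by (auto simp: refl_on_def \<theta>_def l H1)
        show "sym \<theta>" 
        proof (rule symI)
          fix x y assume "(x, y) \<in> \<theta>"
          then have "?i (m x (?i y)) \<in> H" by (simp add: \<theta>_def Hi)
          then show "(y, x) \<in> \<theta>" by (simp add: \<theta>_def im ii)
        qed
        show "trans \<theta>"
        proof (rule transI)
          fix x y z assume "(x, y) \<in> \<theta>" "(y, z) \<in> \<theta>"
          then have "m (m x (?i y)) (m y (?i z)) \<in> H" by (simp add: \<theta>_def Hm)
          then show "(x, z) \<in> \<theta>" by (simp add: \<theta>_def as c)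
        qed
      qed simp
      moreover have "(m z x, m z y) \<in> \<theta> \<longleftrightarrow> (x, y) \<in> \<theta>" for x y z
        using Hn'[of z "m x (?i y)"] by (simp add: \<theta>_def im as)
      moreover have "(m x z, m y z) \<in> \<theta> \<longleftrightarrow> (x, y) \<in> \<theta>" for x y z
        by (simp add: \<theta>_def im as c)
      ultimately have "normal_congruence m \<theta>"
        by (simp add: normal_congruence_def congruence_def)
      then have "\<theta> = Id \<or> \<theta> = UNIV"
        using S by (simp add: simple_group_on_def simple_quasigroup_def)
      moreover have "x \<in> H \<longleftrightarrow> (x, u) \<in> \<theta>" for x
        using inv_one by (simp add: \<theta>_def l)
      ultimately show "H = UNIV \<or> H = {u}" by auto
    qed
  next
    assume N: "\<forall>H. H \<lhd> ?G \<longrightarrow> H = UNIV \<or> H = {u}"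
    have "\<theta> = Id \<or> \<theta> = UNIV" if nc: "normal_congruence m \<theta>" for \<theta>
    proof -
      have eq: "equiv UNIV \<theta>" and zl: "(m z x, m z y) \<in> \<theta> \<longleftrightarrow> (x, y) \<in> \<theta>"
        and zr: "(m x z, m y z) \<in> \<theta> \<longleftrightarrow> (x, y) \<in> \<theta>" for x y z
        using nc unfolding normal_congruence_def congruence_def by (blast, meson, meson)
      have tr: "(x, y) \<in> \<theta> \<Longrightarrow> (y, z) \<in> \<theta> \<Longrightarrow> (x, z) \<in> \<theta>" and sy: "(x, y) \<in> \<theta> \<Longrightarrow> (y, x) \<in> \<theta>"
        and rf: "(x, x) \<in> \<theta>" for x y z
        using equivE[OF eq] by (meson transD, meson symD, meson UNIV_I refl_onD)
      define H where "H = {x. (x, u) \<in> \<theta>}"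
      have "subgroup H ?G"
      proof
        show "\<one>\<^bsub>?G\<^esub> \<in> H" by (simp add: H_def rf)
        fix x assume x: "x \<in> H"
        have "(m (?i x) x, m (?i x) u) \<in> \<theta>" using x zl[of "?i x" x u] by (simp add: H_def)
        then show "?i x \<in> H" by (simp add: H_def l sy)
        fix y assume y: "y \<in> H"
        have "(m x y, m u y) \<in> \<theta>" using x zr[of x y u] by (simp add: H_def)
        then have "(m x y, u) \<in> \<theta>" using y tr by (simp add: H_def l)
        then show "x \<otimes>\<^bsub>?G\<^esub> y \<in> H" by (simp add: H_def)
      qed simp
      moreover have "m (m x h) (?i x) \<in> H" if "h \<in> H" for x h
      proof -
        have "(m (m x h) (?i x), m (m x u) (?i x)) \<in> \<theta>" using that by (simp add: zl zr H_def)
        then show ?thesis by (simp add: H_def l)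
      qed
      ultimately have "H \<lhd> ?G" by (simp add: normal_inv_iff)
      then have "H = UNIV \<or> H = {u}" using N by blast
      moreover have "(x, y) \<in> \<theta> \<longleftrightarrow> m x (?i y) \<in> H" for x y
        using zr[of x "?i y" y] by (simp add: H_def l)
      moreover have "m x (?i y) = u \<longleftrightarrow> x = y" for x y
        using as[of x "?i y" y] by (auto simp: l)
      ultimately show ?thesis by auto
    qed
    then show "simple_group_on m"
      using G group_imp_quasigroup[OF G] by (auto simp: simple_group_on_def simple_quasigroup_def)
  qed
qed

end

theory Submission
  imports Defs "HOL-Computational_Algebra.Polynomial" "HOL-Computational_Algebra.Primes"
begin

text \<open>The kernel of an endomorphism is a normal congruence, so in a simple F-quasigroup each of \<open>e\<close> and
  \<open>f\<close> is constant or injective. If \<open>e\<close> has the single value \<open>u\<close>, the left law reads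
  \<open>x(yz) = (xy)(uz)\<close>: the map \<open>\<psi> = L\<^sub>u\<close> is an automorphism and \<open>x + y = x \<cdot> \<psi>\<inverse> y\<close> is a group with
  \<open>x \<cdot> y = x + \<psi> y\<close>. The case of constant \<open>f\<close> is the mirror image, since passing to the opposite
  operation exchanges \<open>e\<close> and \<open>f\<close>.

  The remaining case rests on the permutations \<open>c\<close> with \<open>c(xu) = x \<cdot> c'(u)\<close>, called left regular
  below; they are the permutations that commute with all \<open>L\<^sub>x L\<^sub>y\<inverse>\<close>. The two F-laws say that every
  translation is a component of an autotopism, and this makes the group of left regular
  permutations invariant under conjugation by translations; hence its orbits are the classes of a
  normal congruence (\<open>regular_orbits_normal\<close>). Moreover the maps \<open>L\<^sub>a\<inverse> L\<^sub>b\<close> with \<open>a = x \<cdot> f(f z)\<close> and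
  \<open>b = x \<cdot> f z\<close> are left regular (\<open>shifted_autotopism\<close>). So there are two possibilities. If the orbits are
  trivial, then \<open>f(f z) = f z\<close>, and injectivity of \<open>f\<close> gives \<open>f = e = id\<close>: the quasigroup is idempotent
  and the F-laws are the distributive laws. If there is a single orbit, the loop isotopic to the
  quasigroup is a group whose right translations are exactly the left regular permutations, and
  \<open>x \<cdot> y = \<phi> x + c + \<psi> y\<close> with automorphisms \<open>\<phi>\<close>, \<open>\<psi>\<close> (\<open>transitive_imp_linear\<close>).

  For an F-quasigroup of this last shape the right law makes every \<open>t - \<psi> t\<close> central, and
  \<open>\<phi>(f x) = (x - \<psi> x) - c\<close>. If \<open>f\<close> is not constant the center is therefore nontrivial, and its cosets form
  a normal congruence, so the group is abelian. Then \<open>e\<close> and \<open>f\<close> are, up to bijections, the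
  endomorphisms \<open>1 - \<phi>\<close> and \<open>1 - \<psi>\<close>; their ranges are invariant subgroups, which shows that an \<open>e\<close> or
  \<open>f\<close> that is not constant is surjective also when the quasigroup is infinite.

  In the converse direction only the class in which \<open>e\<close> and \<open>f\<close> are both permutations needs work.
  There \<open>\<psi> = e\<inverse>\<close>, and \<open>\<psi>\<close>-simplicity of the distributive quasigroup only controls the normal
  congruences that are invariant under \<open>e\<close> and \<open>e\<inverse>\<close>. The orbit congruence is one of them, so the same
  dichotomy leaves the case \<open>x \<cdot> y = \<phi> x + c + \<chi> y\<close> over an abelian group. With \<open>\<lambda> = 1 - \<phi>\<close>, the hypothesis
  is that the group is a simple module over the ring generated by \<open>\<lambda>\<close>, \<open>1 - \<lambda>\<close>, \<open>\<chi>\<close> and their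
  inverses, and the claim is that it remains simple when \<open>\<lambda>\<inverse>\<close> is dropped. For general rings this
  fails, but here the ring is finitely generated, so that a nonzero simple module is a finite field, by the
  Nullstellensatz over the integers. The part of it that is needed, namely that \<open>\<lambda>\<inverse>\<close> is
  a polynomial in \<open>\<lambda>\<close>, is \<open>simple_without_inverse\<close>; it is deduced from the behavior of Goldman ideals
  in polynomial rings.\<close>

section \<open>Goldman ideals of polynomial rings\<close>

locale prime_ideal_set =
  fixes P :: "'r::comm_ring_1 set"
  assumes zero_mem: "0 \<in> P"
    and add_mem: "a \<in> P \<Longrightarrow> b \<in> P \<Longrightarrow> a + b \<in> P"
    and mult_mem: "a \<in> P \<Longrightarrow> r * a \<in> P"
    and one_not_mem: "1 \<notin> P"
    and prime_mem: "a * b \<in> P \<Longrightarrow> a \<in> P \<or> b \<in> P"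
begin

lemma uminus_mem: "a \<in> P \<Longrightarrow> - a \<in> P"
  using mult_mem[of a "-1"] by simp

lemma diff_mem: "a \<in> P \<Longrightarrow> b \<in> P \<Longrightarrow> a - b \<in> P"
  using add_mem[of a "-b"] uminus_mem[of b] by simp

lemma mult_mem': "a \<in> P \<Longrightarrow> a * r \<in> P"
  using mult_mem[of a r] by (simp add: mult.commute)

lemma sum_mem: "(\<And>i. i \<in> A \<Longrightarrow> f i \<in> P) \<Longrightarrow> sum f A \<in> P"
  by (induction A rule: infinite_finite_induct) (auto simp: zero_mem add_mem)

lemma power_mem_imp_mem: "a ^ n \<in> P \<Longrightarrow> a \<in> P"
  by (induction n) (use one_not_mem prime_mem in auto)

lemma diff_mem_trans: "a - b \<in> P \<Longrightarrow> b - c \<in> P \<Longrightarrow> a - c \<in> P"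
  using add_mem[of "a - b" "b - c"] by simp

lemma mem_cong: "a - b \<in> P \<Longrightarrow> a \<in> P \<longleftrightarrow> b \<in> P"
  using add_mem[of "a - b" b] diff_mem[of a "a - b"] by auto

lemma mult_cong: "a - b \<in> P \<Longrightarrow> c - d \<in> P \<Longrightarrow> a * c - b * d \<in> P"
  using add_mem[OF mult_mem'[of "a - b" c] mult_mem[of "c - d" b]] by (simp add: algebra_simps)

lemma power_cong: "a - b \<in> P \<Longrightarrow> a ^ n - b ^ n \<in> P"
  by (induction n) (auto simp: zero_mem intro!: mult_cong)

end

text \<open>The quotient by a prime ideal with this property is a Goldman domain: inverting the one
  element \<open>b\<close> already yields its field of fractions. The condition is phrased inside the ring, so that no
  quotient or fraction field has to be formed.\<close>

definition goldman :: "'r::comm_ring_1 set \<Rightarrow> bool" where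
  "goldman P \<longleftrightarrow> (\<exists>b. b \<notin> P \<and> (\<forall>a. a \<notin> P \<longrightarrow> (\<exists>n c. b ^ n - a * c \<in> P)))"

definition contract :: "'r::comm_ring_1 poly set \<Rightarrow> 'r set" where
  "contract P = {r. [:r:] \<in> P}"

lemma prime_ideal_set_contract:
  assumes "prime_ideal_set P"
  shows "prime_ideal_set (contract P)"
proof -
  interpret prime_ideal_set P by fact
  show ?thesis
  proof
    show "0 \<in> contract P" using zero_mem by (simp add: contract_def)
    show "1 \<notin> contract P" using one_not_mem by (simp add: contract_def flip: one_pCons)
    show "a + b \<in> contract P" if "a \<in> contract P" "b \<in> contract P" for a b
      using that add_mem[of "[:a:]" "[:b:]"] by (simp add: contract_def)
    show "r * a \<in> contract P" if "a \<in> contract P" for a r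
      using that mult_mem[of "[:a:]" "[:r:]"] by (simp add: contract_def mult.commute)
    show "a \<in> contract P \<or> b \<in> contract P" if "a * b \<in> contract P" for a b
      using that prime_mem[of "[:a:]" "[:b:]"] by (simp add: contract_def mult.commute)
  qed
qed

locale poly_prime_ideal = prime_ideal_set P for P :: "'r::idom poly set"
begin

abbreviation "p \<equiv> contract P"

sublocale p: prime_ideal_set p
  by (rule prime_ideal_set_contract) unfold_locales

lemma coeffs_mem_imp_mem: "(\<And>i. coeff h i \<in> p) \<Longrightarrow> h \<in> P"
proof (induction h)
  case 0
  then show ?case by (simp add: zero_mem)
next
  case (pCons a h)
  have "coeff h i \<in> p" for i using pCons.prems[of "Suc i"] by simp
  then have "[:0, 1:] * h \<in> P" using pCons.IH mult_mem by blast
  moreover have "[:a:] \<in> P" using pCons.prems[of 0] by (simp add: contract_def)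
  ultimately show ?case using add_mem[of "[:a:]" "[:0, 1:] * h"] by simp
qed

text \<open>Terms with coefficients in \<open>p\<close> vanish modulo \<open>P\<close>. Cutting off those above the last coefficient
  outside \<open>p\<close> turns the degree over the quotient of the coefficient ring into an ordinary degree.\<close>

lemma trim_leading:
  assumes "coeff h k \<notin> p"
  obtains h' where "h - h' \<in> P" "lead_coeff h' \<notin> p" "coeff h (degree h') \<notin> p"
    "\<And>i. i > degree h' \<Longrightarrow> coeff h i \<in> p"
proof -
  define j where "j = (GREATEST i. coeff h i \<notin> p)"
  have bd: "i \<le> degree h" if "coeff h i \<notin> p" for i
    using that p.zero_mem le_degree by metis
  have j1: "coeff h j \<notin> p" unfolding j_def using GreatestI_nat[of "\<lambda>i. coeff h i \<notin> p", OF assms] bd by blast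
  have j2: "i \<le> j" if "coeff h i \<notin> p" for i unfolding j_def using Greatest_le_nat[of "\<lambda>i. coeff h i \<notin> p", OF that] bd by blast
  define h' where "h' = poly_cutoff (Suc j) h"
  have cf: "coeff h' i = (if i \<le> j then coeff h i else 0)" for i
    by (auto simp: h'_def coeff_poly_cutoff)
  have "coeff h' j \<noteq> 0" using j1 p.zero_mem by (auto simp: cf)
  then have d: "degree h' = j" by (intro antisym degree_le le_degree) (auto simp: cf)
  show thesis
  proof (rule that)
    show "h - h' \<in> P" by (rule coeffs_mem_imp_mem) (use j2 p.zero_mem in \<open>force simp: cf\<close>)
  qed (use j1 j2 d in \<open>force simp: cf\<close>)+
qed

text \<open>If the variable were transcendental modulo \<open>P\<close>, the quotient by \<open>P\<close> would be a polynomial ring \<open>A[X]\<close>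
  over a domain. The element \<open>1 + X b\<close> would divide a power of \<open>b\<close>; as \<open>X b\<close> is \<open>-1\<close> modulo
  \<open>1 + X b\<close>, it would divide \<open>1\<close>, which its degree forbids.\<close>

lemma goldman_imp_algebraic:
  assumes "goldman P"
  obtains g where "g \<in> P" "lead_coeff g \<notin> p"
proof -
  obtain b where b: "b \<notin> P" "\<And>a. a \<notin> P \<Longrightarrow> \<exists>n c. b ^ n - a * c \<in> P"
    using assms unfolding goldman_def by blast
  have "\<exists>g k. g \<in> P \<and> coeff g k \<notin> p"
  proof (rule ccontr)
    assume "\<not> ?thesis"
    then have P: "\<And>g k. g \<in> P \<Longrightarrow> coeff g k \<in> p" by blast
    \<comment> \<open>The element whose invertibility after inverting \<open>b\<close> is absurd for reasons of degree.\<close>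
    define a where "a = 1 + [:0, 1:] * b"
    have "a \<notin> P"
    proof
      assume "a \<in> P"
      have "coeff b k \<in> p" for k using P[OF \<open>a \<in> P\<close>, of "Suc k"] by (simp add: a_def)
      then show False using b(1) coeffs_mem_imp_mem by blast
    qed
    then obtain n c where nc: "b ^ n - a * c \<in> P" using b(2) by blast
    have "(- 1) ^ n - ([:0,1:] * b) ^ n \<in> (\<lambda>c. a * c) ` UNIV"
    proof -
      have "(- 1) - ([:0,1:] * b) dvd (- 1) ^ n - ([:0,1:] * b) ^ n"
        by (simp add: power_diff_sumr2)
      moreover have "(- 1) - ([:0,1:] * b) = - a" by (simp add: a_def)
      ultimately show ?thesis by (metis dvd_def minus_dvd_iff rangeI)
    qed
    then obtain c1 where c1: "(- 1) ^ n - ([:0,1:] * b) ^ n = a * c1" by blast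
    \<comment> \<open>From \<open>b\<^sup>n \<equiv> a c\<close> and \<open>(X b)\<^sup>n \<equiv> (-1)\<^sup>n\<close> modulo \<open>a\<close>: an inverse of \<open>a\<close> modulo \<open>P\<close>.\<close>
    define c2 where "c2 = (- 1) ^ n * (c1 + [:0,1:] ^ n * c)"
    have "1 - a * c2 = (- 1) ^ n * ((- 1) ^ n - a * c1 - a * ([:0,1:] ^ n * c))"
      by (simp add: c2_def algebra_simps flip: power_mult_distrib)
    also have "\<dots> = (- 1) ^ n * ([:0,1:] ^ n * (b ^ n - a * c))"
    proof -
      have "s - (s - X * B) - a * (X * c) = X * (B - a * c)" for s X B :: "'r poly"
        by (simp add: algebra_simps)
      then show ?thesis unfolding c1[symmetric] power_mult_distrib by metis
    qed
    finally have in_P: "1 - a * c2 \<in> P" using nc mult_mem by presburger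
    have "\<exists>k. coeff b k \<notin> p" using b(1) coeffs_mem_imp_mem by blast
    then obtain b' where b': "b - b' \<in> P" "lead_coeff b' \<notin> p" using trim_leading by metis
    have "c2 \<notin> P"
    proof
      assume "c2 \<in> P"
      then have "1 - a * c2 + a * c2 \<in> P" using in_P by (intro add_mem mult_mem)
      then show False using one_not_mem by simp
    qed
    then have "\<exists>k. coeff c2 k \<notin> p" using coeffs_mem_imp_mem by blast
    then obtain c' where c': "c2 - c' \<in> P" "lead_coeff c' \<notin> p" using trim_leading by metis
    have "(1 - a * c2) - (1 - (1 + [:0,1:] * b') * c') = - ((1 + [:0,1:] * b) * c2 - (1 + [:0,1:] * b') * c')"
      by (simp add: a_def)
    also have "\<dots> \<in> P"
      by (intro uminus_mem mult_cong c') (use mult_mem[OF b'(1), of "[:0,1:]"] in \<open>simp add: algebra_simps\<close>)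
    finally have "1 - (1 + [:0,1:] * b') * c' \<in> P" using in_P mem_cong by blast
    then have *: "coeff (1 - (1 + [:0,1:] * b') * c') (Suc (degree b' + degree c')) \<in> p" by (rule P)
    have "coeff (1 - (1 + [:0,1:] * b') * c') (Suc (degree b' + degree c'))
       = - (lead_coeff b' * lead_coeff c')"
      by (simp add: algebra_simps coeff_mult_degree_sum coeff_eq_0)
    then show False using * b'(2) c'(2) p.prime_mem p.uminus_mem by fastforce
  qed
  then obtain g k where "g \<in> P" "coeff g k \<notin> p" by blast
  then show thesis using trim_leading[of g k] that mem_cong by metis
qed

text \<open>Let \<open>B = A[x]\<close> be the quotient by \<open>P\<close> and \<open>c x\<^sup>r + \<dots>\<close> a polynomial of least degree annihilating \<open>x\<close>,
  so that \<open>1, x, \<dots>, x\<^sup>r\<^sup>-\<^sup>1\<close> are independent over \<open>A\<close>. The Goldman element \<open>b\<close> of \<open>B\<close> is algebraic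
  over \<open>A\<close>, hence has a nonzero multiple \<open>d = b q\<close> in \<open>A\<close>. If a nonzero \<open>a \<in> A\<close> divides \<open>b\<^sup>n\<close> in \<open>B\<close>, it
  divides \<open>d\<^sup>n\<close>; after multiplication by a power of \<open>c\<close> the cofactor is a combination of the
  independent powers, and comparing constant terms shows that \<open>a\<close> divides a power of \<open>c d\<close> in \<open>A\<close>.\<close>

lemma goldman_contract:
  assumes G: "goldman P"
  shows "goldman p"
proof -
  obtain b where b: "b \<notin> P" "\<And>a. a \<notin> P \<Longrightarrow> \<exists>n c. b ^ n - a * c \<in> P"
    using G unfolding goldman_def by blast
  obtain g0 where g0: "g0 \<in> P \<and> lead_coeff g0 \<notin> p" using goldman_imp_algebraic[OF G] by blast
  define g where "g = (ARG_MIN degree g. g \<in> P \<and> lead_coeff g \<notin> p)"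
  define c where "c = lead_coeff g"
  have g: "g \<in> P" "c \<notin> p" and gmin: "\<And>h. h \<in> P \<Longrightarrow> lead_coeff h \<notin> p \<Longrightarrow> degree g \<le> degree h"
    using arg_min_natI[of "\<lambda>g. g \<in> P \<and> lead_coeff g \<notin> p", OF g0] 
      arg_min_nat_le[of "\<lambda>g. g \<in> P \<and> lead_coeff g \<notin> p" _ degree]
    unfolding g_def c_def by auto
  have g_ne: "g \<noteq> 0" using g p.zero_mem by (auto simp: c_def)
  have small: "coeff h i \<in> p" if "h \<in> P" "degree h < degree g" for h i
  proof (rule ccontr)
    assume "coeff h i \<notin> p"
    then obtain h' where h': "h - h' \<in> P" "lead_coeff h' \<notin> p" "coeff h (degree h') \<notin> p" by (rule trim_leading)
    have "degree h' \<le> degree h" using h'(3) p.zero_mem le_degree by metis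
    moreover have "h' \<in> P" using that(1) h'(1) mem_cong by blast
    ultimately show False using gmin[of h'] h'(2) that(2) by simp
  qed
  have deg_g: "degree g > 0"
  proof (rule ccontr)
    assume "\<not> ?thesis"
    then have "g = [:c:]" by (auto simp: c_def elim: degree_eq_zeroE)
    then show False using g by (simp add: contract_def)
  qed
  \<comment> \<open>A nonzero multiple of \<open>b\<close> in the coefficient ring: a polynomial of least degree in the ideal generated by \<open>b\<close> and \<open>P\<close>.\<close>
  have "\<exists>d q. d \<notin> p \<and> [:d:] - b * q \<in> P"
  proof -
    \<comment> \<open>The ideal generated by \<open>b\<close> and \<open>P\<close>; it contains \<open>g\<close>, so it has elements with leading coefficient outside \<open>p\<close>.\<close>
    define J where "J = {h. \<exists>q. h - b * q \<in> P}"
    have J_P: "h \<in> J" if "h \<in> P" for h using that by (auto simp: J_def intro!: exI[of _ 0])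
    have J_lin: "s * h - h1 \<in> J" if h: "h \<in> J" "h1 \<in> J" for s h h1
    proof -
      obtain q q1 where "h - b * q \<in> P" "h1 - b * q1 \<in> P" using h by (auto simp: J_def)
      then have "s * (h - b * q) - (h1 - b * q1) \<in> P"
        by (metis diff_mem mult_mem)
      then have "(s * h - h1) - b * (s * q - q1) \<in> P" by (simp add: algebra_simps)
      then show ?thesis by (auto simp: J_def)
    qed
    define h where "h = (ARG_MIN degree h. h \<in> J \<and> lead_coeff h \<notin> p)"
    define l where "l = lead_coeff h"
    have h: "h \<in> J" "l \<notin> p" and hmin: "\<And>h1. h1 \<in> J \<Longrightarrow> lead_coeff h1 \<notin> p \<Longrightarrow> degree h \<le> degree h1"
      using arg_min_natI[of "\<lambda>h. h \<in> J \<and> lead_coeff h \<notin> p" g] 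
        arg_min_nat_le[of "\<lambda>h. h \<in> J \<and> lead_coeff h \<notin> p" _ degree] J_P g
      unfolding h_def l_def c_def by auto
    have h_ne: "h \<noteq> 0" using h p.zero_mem by (auto simp: l_def)
    have reduce: "\<exists>n Q r. [:l:] ^ n * w - h * Q = r \<and> (r = 0 \<or> degree r < degree h) \<and> (\<forall>i. coeff r i \<in> p)"
      if w: "w \<in> J" for w
    proof -
      obtain Q r where Qr: "pseudo_divmod w h = (Q, r)" by fastforce
      define n where "n = Suc (degree w) - degree h"
      have 1: "[:l:] ^ n * w - h * Q = r" and 2: "r = 0 \<or> degree r < degree h"
        using pseudo_divmod[OF h_ne Qr] by (simp_all add: n_def l_def poly_const_pow)
      have "[:l:] ^ n * w - Q * h \<in> J"
        using J_lin[OF w J_lin[OF h(1) J_P[OF zero_mem], of Q]] by simp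
      then have rJ: "r \<in> J" using 1 by (simp add: mult.commute)
      have "coeff r i \<in> p" for i
      proof (rule ccontr)
        assume "coeff r i \<notin> p"
        then obtain r' where r': "r - r' \<in> P" "lead_coeff r' \<notin> p" "coeff r (degree r') \<notin> p" by (rule trim_leading)
        have "r \<noteq> 0" using \<open>coeff r i \<notin> p\<close> p.zero_mem by auto
        moreover have "degree r' \<le> degree r" using r'(3) p.zero_mem le_degree by metis
        moreover have "1 * r - (r - r') \<in> J" by (rule J_lin[OF rJ J_P[OF r'(1)]])
        ultimately show False using hmin[of r'] r'(2) 2 by simp
      qed
      then show ?thesis using 1 2 by blast
    qed
    have "degree h = 0"
    proof (rule ccontr)
      assume dh: "degree h \<noteq> 0"
      have lP: "[:l:] ^ n \<notin> P" for n using h(2) power_mem_imp_mem by (auto simp: contract_def)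
      obtain n Q r where r: "[:l:] ^ n * g - h * Q = r" "r = 0 \<or> degree r < degree h" "\<And>i. coeff r i \<in> p"
        using reduce[OF J_P[OF g(1)]] by blast
      have "r \<in> P" using r(3) coeffs_mem_imp_mem by blast
      \<comment> \<open>So \<open>h\<close> or \<open>Q\<close> vanishes modulo \<open>P\<close>; the first kills \<open>b\<close>, the second contradicts the choice of \<open>g\<close>, since the degree of \<open>Q\<close> is smaller.\<close>
      then have "h * Q \<in> P" using diff_mem[OF mult_mem[OF g(1), of "[:l:] ^ n"], of r] r(1) by (simp add: algebra_simps)
      then consider "h \<in> P" | "Q \<in> P" using prime_mem by blast
      then show False
      proof cases
        case 1
        have "b \<in> J" by (auto simp: J_def zero_mem intro!: exI[of _ 1])
        then obtain n Q r where r: "[:l:] ^ n * b - h * Q = r" "\<And>i. coeff r i \<in> p"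
          using reduce by blast
        have "r + Q * h \<in> P" using 1 coeffs_mem_imp_mem[OF r(2)] by (intro add_mem mult_mem)
        then have "[:l:] ^ n * b \<in> P" using r(1) by (simp add: algebra_simps)
        then show False using b(1) lP prime_mem by blast
      next
        case 2
        have lc: "coeff ([:l:] ^ n * g) (degree g) = l ^ n * c" by (simp add: poly_const_pow c_def)
        have lcp: "l ^ n * c \<notin> p" using h(2) g(2) p.prime_mem p.power_mem_imp_mem by blast
        have ne: "\<exists>k. coeff Q k \<notin> p"
        proof (rule ccontr)
          assume "\<not> ?thesis"
          then have "coeff (h * Q) k \<in> p" for k unfolding coeff_mult
            by (intro p.sum_mem) (auto intro: p.mult_mem)
          then have "coeff r (degree g) + coeff (h * Q) (degree g) \<in> p" using r(3) by (intro p.add_mem) auto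
          then show False using lcp lc r(1) by (metis coeff_diff diff_add_cancel)
        qed
        then obtain Q' where Q': "Q - Q' \<in> P" "lead_coeff Q' \<notin> p" "coeff Q (degree Q') \<notin> p"
          "\<And>i. i > degree Q' \<Longrightarrow> coeff Q i \<in> p" using trim_leading by metis
        have "Q' \<in> P" using 2 Q'(1) mem_cong by blast
        then have le: "degree g \<le> degree Q'" using gmin Q'(2) by blast
        let ?k = "degree Q' + degree h"
        have "coeff r ?k = 0" "coeff g ?k = 0" using r(2) le dh by (auto intro!: coeff_eq_0)
        then have "coeff (h * Q) ?k = 0" using arg_cong[OF r(1), of "\<lambda>f. coeff f ?k"] by (simp add: poly_const_pow)
        moreover have "coeff (h * Q) ?k - l * coeff Q (degree Q') \<in> p"
        proof -
          have "coeff (h * Q) ?k = (\<Sum>i\<le>?k. coeff h i * coeff Q (?k - i))" by (simp add: coeff_mult)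
          also have "\<dots> = l * coeff Q (degree Q') + (\<Sum>i\<in>{..?k} - {degree h}. coeff h i * coeff Q (?k - i))"
            by (subst sum.remove[of _ "degree h"]) (auto simp: l_def)
          finally have "coeff (h * Q) ?k - l * coeff Q (degree Q') = (\<Sum>i\<in>{..?k} - {degree h}. coeff h i * coeff Q (?k - i))" by simp
          also have "\<dots> \<in> p"
          proof (rule p.sum_mem)
            fix i assume "i \<in> {..?k} - {degree h}"
            then consider "i > degree h" | "?k - i > degree Q'" by force
            then show "coeff h i * coeff Q (?k - i) \<in> p"
              by cases (auto simp: coeff_eq_0 p.zero_mem intro!: p.mult_mem Q'(4))
          qed
          finally show ?thesis .
        qed
        ultimately have "l * coeff Q (degree Q') \<in> p" using p.uminus_mem by fastforce
        then show False using h(2) Q'(3) p.prime_mem by blast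
      qed
    qed
    then obtain d where "h = [:d:]" by (metis degree_eq_zeroE)
    then show ?thesis using h by (auto simp: J_def l_def)
  qed
  then obtain d q where dq: "d \<notin> p" "[:d:] - b * q \<in> P" by blast
  have "\<exists>n e. (c * d) ^ n - a * e \<in> p" if a: "a \<notin> p" for a
  proof -
    have "[:a:] \<notin> P" using a by (simp add: contract_def)
    then obtain n y where ny: "b ^ n - [:a:] * y \<in> P" using b(2) by blast
    define w where "w = y * q ^ n"
    have "[:d:] ^ n - (b * q) ^ n \<in> P" by (rule power_cong[OF dq(2)])
    moreover have "(b * q) ^ n - [:a:] * w \<in> P"
      using mult_mem'[OF ny, of "q ^ n"] by (simp add: algebra_simps power_mult_distrib w_def)
    ultimately have 1: "[:d:] ^ n - [:a:] * w \<in> P" by (rule diff_mem_trans)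
    obtain Q r where Qr: "pseudo_divmod w g = (Q, r)" by fastforce
    \<comment> \<open>Pseudo-division by \<open>g\<close> reduces the cofactor below the degree of \<open>g\<close> at the cost of a power of \<open>c\<close>.\<close>
    define N where "N = Suc (degree w) - degree g"
    have 2: "[:c:] ^ N * w = g * Q + r" and 3: "r = 0 \<or> degree r < degree g"
      using pseudo_divmod[OF g_ne Qr] by (simp_all add: N_def c_def poly_const_pow)
    define h where "h = [:c ^ N * d ^ n:] - [:a:] * r"
    have "h = [:c:] ^ N * ([:d:] ^ n - [:a:] * w) + [:a:] * (g * Q)"
    proof -
      have "r = [:c:] ^ N * w - g * Q" using 2 by simp
      moreover have "h = [:c:] ^ N * [:d:] ^ n - [:a:] * r" by (simp add: h_def poly_const_pow)
      moreover have "C * D - A * (C * w - G) = C * (D - A * w) + A * G" for A C D G :: "'r poly"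
        by (simp add: algebra_simps)
      ultimately show ?thesis by metis
    qed
    moreover have "\<dots> \<in> P" using 1 g(1) by (intro add_mem mult_mem mult_mem')
    ultimately have "h \<in> P" by simp
    moreover have "degree h < degree g"
      unfolding h_def using 3 deg_g by (intro degree_diff_less) (auto intro: le_less_trans[OF degree_smult_le])
    ultimately have "coeff h 0 \<in> p" by (rule small)
    then have "c ^ N * d ^ n - a * coeff r 0 \<in> p" by (simp add: h_def)
    then have "c ^ n * d ^ N * (c ^ N * d ^ n - a * coeff r 0) \<in> p" by (rule p.mult_mem)
    then have "(c * d) ^ (n + N) - a * (c ^ n * d ^ N * coeff r 0) \<in> p"
      by (simp add: algebra_simps power_add power_mult_distrib)
    then show ?thesis by blast
  qed
  moreover have "c * d \<notin> p" using g(2) dq(1) p.prime_mem by blast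
  ultimately show ?thesis unfolding goldman_def by blast
qed

end

text \<open>The zero ideal of the integers is not a Goldman ideal, because a prime that does not divide \<open>b\<close>
  divides no power of \<open>b\<close>. So \<open>p\<close> is maximal, generated by its least positive element.\<close>

lemma goldman_int_field:
  fixes p :: "int set"
  assumes "prime_ideal_set p" "goldman p" "a \<notin> p"
  obtains u where "u * a - 1 \<in> p"
proof -
  interpret prime_ideal_set p by fact
  obtain b where b: "b \<notin> p" "\<And>a. a \<notin> p \<Longrightarrow> \<exists>n c. b ^ n - a * c \<in> p"
    using assms unfolding goldman_def by blast
  have "\<exists>k>0. k \<in> p"
  proof (rule ccontr)
    assume N: "\<not> ?thesis"
    have p: "k = 0" if "k \<in> p" for k using N uminus_mem[OF that] that by (metis linorder_neqE_linordered_idom neg_0_less_iff_less)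
    obtain q :: nat where q: "prime q" "q > nat \<bar>b\<bar>" using bigger_prime by blast
    have "int q \<notin> p" using p[of "int q"] q by auto
    then obtain n c where "b ^ n - int q * c \<in> p" using b(2) by blast
    then have "int q dvd b ^ n" using p[of "b ^ n - int q * c"] by auto
    then have "int q dvd b" using q prime_dvd_power[of "int q"] by auto
    moreover have "b \<noteq> 0" using b(1) zero_mem by auto
    ultimately show False using q(2) dvd_imp_le_int[of b "int q"] by simp
  qed
  then obtain k where k: "k > 0 \<and> k \<in> p" by blast
  define q where "q = (ARG_MIN nat k. k > 0 \<and> k \<in> p)"
  have q: "q > 0" "q \<in> p" and qmin: "\<And>k. k > 0 \<Longrightarrow> k \<in> p \<Longrightarrow> q \<le> k"
    using arg_min_natI[of "\<lambda>k. k > 0 \<and> k \<in> p", OF k, of nat]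
      arg_min_nat_le[of "\<lambda>k. k > 0 \<and> k \<in> p" _ nat]
    unfolding q_def by (auto simp: nat_le_eq_zle)
  obtain h where h: "q = gcd a q * h" by (meson dvdE gcd_dvd2)
  have gpos: "gcd a q > 0" using q by simp
  have hpos: "h > 0" using h q gpos by (metis zero_less_mult_pos)
  have "gcd a q \<notin> p"
  proof
    assume *: "gcd a q \<in> p"
    obtain s where "a = gcd a q * s" by (meson dvdE gcd_dvd1)
    then show False using mult_mem'[OF *, of s] assms(3) by simp
  qed
  then have "h \<in> p" using prime_mem[of "gcd a q" h] h q(2) by simp
  then have "q \<le> h" using qmin hpos by blast
  then have "gcd a q * h \<le> 1 * h" using h by linarith
  then have "gcd a q \<le> 1" using hpos by (simp only: mult_le_cancel_right)
  then have "gcd a q = 1" using gpos by linarith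
  then obtain u v where "u * a + v * q = 1" using bezout_int by metis
  then have "u * a - 1 = - v * q" by simp
  then have "u * a - 1 \<in> p" using mult_mem[OF q(2), of "- v"] by simp
  then show thesis by (rule that)
qed

text \<open>Two contractions lead to a prime field \<open>\<int>/p\<close> over which the inner variable is algebraic. The lowest
  coefficient of its equation that is not in \<open>p\<close> is a unit modulo \<open>p\<close>, and dividing by it exhibits the
  inverse of the variable.\<close>

lemma goldman_int_poly_poly:
  fixes P :: "int poly poly set"
  assumes "prime_ideal_set P" "goldman P" "[:[:0, 1:]:] \<notin> P"
  obtains h where "[:[:0, 1:] * h - 1:] \<in> P"
proof -
  interpret Q: poly_prime_ideal P using assms(1) by (simp add: poly_prime_ideal_def)
  let ?P1 = "contract P"
  interpret poly_prime_ideal ?P1 by (simp add: poly_prime_ideal_def Q.p.prime_ideal_set_axioms)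
  have G: "goldman ?P1" by (rule Q.goldman_contract[OF assms(2)])
  have x: "[:0, 1:] \<notin> ?P1" using assms(3) by (simp add: contract_def)
  obtain g where g: "g \<in> ?P1" "lead_coeff g \<notin> p" using goldman_imp_algebraic[OF G] by blast
  have "\<exists>h. [:0, 1:] * h - 1 \<in> ?P1" if "g \<in> ?P1" "coeff g k \<notin> p" for g k
    using that
  proof (induction g arbitrary: k)
    case 0
    then show ?case using p.zero_mem by simp
  next
    case (pCons c g)
    show ?case
    proof (cases "c \<in> p")
      case True
      then have "[:c:] \<in> ?P1" by (simp add: contract_def)
      then have "[:0, 1:] * g \<in> ?P1" using pCons.prems(1) Q.p.diff_mem[of "pCons c g" "[:c:]"] by simp
      then have "g \<in> ?P1" using x Q.p.prime_mem by blast
      moreover have "coeff g (k - 1) \<notin> p" using pCons.prems(2) True by (cases k) auto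
      ultimately show ?thesis by (rule pCons.IH)
    next
      case False
      then obtain u where "u * c - 1 \<in> p"
        using goldman_int_field[OF p.prime_ideal_set_axioms goldman_contract[OF G]] by blast
      then have "[:u * c - 1:] \<in> ?P1" by (simp add: contract_def)
      moreover have "[:u:] * pCons c g \<in> ?P1" using pCons.prems(1) by (rule Q.p.mult_mem)
      ultimately have "[:u * c - 1:] - [:u:] * pCons c g \<in> ?P1" by (rule Q.p.diff_mem)
      moreover have "[:u * c - 1:] - [:u:] * pCons c g = [:0, 1:] * (- smult u g) - 1"
        by (simp add: one_pCons)
      ultimately show ?thesis by metis
    qed
  qed
  then show thesis using g that by (auto simp: contract_def)
qed

section \<open>Abelian groups acted on by two commuting automorphisms\<close>

context group_add
begin

definition additive_map :: "('a \<Rightarrow> 'a) \<Rightarrow> bool" where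
  "additive_map h \<longleftrightarrow> (\<forall>x y. h (x + y) = h x + h y)"

definition additive_subgroup :: "'a set \<Rightarrow> bool" where
  "additive_subgroup H \<longleftrightarrow> 0 \<in> H \<and> (\<forall>x\<in>H. \<forall>y\<in>H. x - y \<in> H)"

lemma additive_mapD: "additive_map h \<Longrightarrow> h (x + y) = h x + h y"
  by (simp add: additive_map_def)

lemma additive_map_0: "additive_map h \<Longrightarrow> h 0 = 0"
  using additive_mapD[of h 0 0] by (metis add.left_cancel add_0_right)

lemma additive_map_minus: "additive_map h \<Longrightarrow> h (- x) = - h x"
  using additive_mapD[of h "- x" x] by (simp add: additive_map_0 eq_neg_iff_add_eq_0)

lemma additive_map_diff: "additive_map h \<Longrightarrow> h (x - y) = h x - h y"
  using additive_mapD[of h x "- y"] by (simp add: additive_map_minus)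

lemma additive_subgroup_minus: "additive_subgroup H \<Longrightarrow> x \<in> H \<Longrightarrow> - x \<in> H"
  unfolding additive_subgroup_def by (metis diff_0)

lemma additive_subgroup_add: "additive_subgroup H \<Longrightarrow> x \<in> H \<Longrightarrow> y \<in> H \<Longrightarrow> x + y \<in> H"
  using additive_subgroup_minus[of H y] unfolding additive_subgroup_def by (metis diff_minus_eq_add)

end

context ab_group_add
begin

definition ring_action :: "('r::comm_ring_1 \<Rightarrow> 'a \<Rightarrow> 'a) \<Rightarrow> bool" where
  "ring_action act \<longleftrightarrow> (\<forall>v. act 1 v = v) \<and> (\<forall>p q v. act (p + q) v = act p v + act q v)
     \<and> (\<forall>p q v. act (p * q) v = act p (act q v)) \<and> (\<forall>p. additive_map (act p))"

lemma ring_actionD: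
  assumes "ring_action act"
  shows "act 1 v = v" "act (p + q) v = act p v + act q v" "act (p * q) v = act p (act q v)"
    "additive_map (act p)" "act 0 v = 0" "act (- p) v = - act p v" "act (p - q) v = act p v - act q v"
proof -
  show add: "act (p + q) v = act p v + act q v" for p q v using assms by (simp add: ring_action_def)
  show "act 1 v = v" "act (p * q) v = act p (act q v)" "additive_map (act p)"
    using assms by (simp_all add: ring_action_def)
  show z: "act 0 v = 0" for v using add[of 0 0 v] by simp
  show m: "act (- p) v = - act p v" for p using add[of "- p" p v] by (simp add: z eq_neg_iff_add_eq_0)
  show "act (p - q) v = act p v - act q v" using add[of p "- q" v] by (simp add: m)
qed

lemma int_ring_action: "\<exists>act :: int \<Rightarrow> 'a \<Rightarrow> 'a. ring_action act"
proof -
  define nact :: "nat \<Rightarrow> 'a \<Rightarrow> 'a" where "nact n v = ((+) v ^^ n) 0" for n v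
  have n0: "nact 0 v = 0" "nact (Suc n) v = v + nact n v" for n v by (simp_all add: nact_def)
  have nadd: "nact (k + n) v = nact k v + nact n v" for k n v
    by (induction k) (simp_all add: n0 add.assoc)
  have nvec: "nact n (v + w) = nact n v + nact n w" for n v w
    by (induction n) (simp_all add: n0 algebra_simps)
  have nmult: "nact (k * n) v = nact k (nact n v)" for k n v
    by (induction k) (simp_all add: n0 nadd)
  have nz: "nact n 0 = 0" for n by (induction n) (simp_all add: n0)
  have nneg: "nact n (- v) = - nact n v" for n v
    using nvec[of n "- v" v] by (simp add: nz eq_neg_iff_add_eq_0)
  define act :: "int \<Rightarrow> 'a \<Rightarrow> 'a" where "act k v = nact (nat k) v - nact (nat (- k)) v" for k v
  have act: "act (int i - int j) v = nact i v - nact j v" for i j v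
  proof (cases "i \<ge> j")
    case True
    then have "nact i v = nact (i - j) v + nact j v" using nadd[of "i - j" j v] by simp
    then show ?thesis using True by (simp add: act_def n0 nat_diff_distrib')
  next
    case False
    then have "nact j v = nact (j - i) v + nact i v" using nadd[of "j - i" i v] by simp
    moreover have "- x = y - (x + y)" for x y :: 'a by (metis add_diff_cancel_right' minus_diff_eq)
    ultimately show ?thesis using False by (simp add: act_def n0 nat_diff_distrib')
  qed
  have rep: "\<exists>i j. k = int i - int j" for k by (meson int_diff_cases)
  have "act (k + l) v = act k v + act l v" for k l v
  proof -
    obtain i j i' j' where [simp]: "k = int i - int j" "l = int i' - int j'" using rep by meson
    have "k + l = int (i + i') - int (j + j')" by simp
    then have "act (k + l) v = nact (i + i') v - nact (j + j') v" using act by presburger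
    then show ?thesis by (simp add: act nadd algebra_simps)
  qed
  moreover have av: "act k (v + w) = act k v + act k w" for k v w
    by (simp add: act_def nvec algebra_simps)
  moreover have "act (k * l) v = act k (act l v)" for k l v
  proof -
    obtain i j i' j' where [simp]: "k = int i - int j" "l = int i' - int j'" using rep by meson
    have "k * l = int (i * i' + j * j') - int (i * j' + j * i')" by (simp add: algebra_simps)
    then have "act (k * l) v = nact (i * i' + j * j') v - nact (i * j' + j * i') v" using act by presburger
    moreover have nd: "nact n (a - b) = nact n a - nact n b" for n a b using nvec[of n a "- b"] by (simp add: nneg)
    have "act k (act l v) = nact i (nact i' v) - nact i (nact j' v) - (nact j (nact i' v) - nact j (nact j' v))"
      by (simp only: \<open>k = _\<close> \<open>l = _\<close> act nd)
    ultimately show ?thesis by (simp only: nadd nmult) (simp add: algebra_simps)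
  qed
  moreover have "act 1 v = v" for v by (simp add: act_def n0)
  ultimately have "ring_action act" by (simp add: ring_action_def additive_map_def)
  then show ?thesis by blast
qed

lemma int_action_commute:
  assumes "ring_action (act :: int \<Rightarrow> 'a \<Rightarrow> 'a)" "additive_map h"
  shows "h (act k v) = act k (h v)"
proof (induction k rule: int_induct[of _ 0])
  case base
  then show ?case by (simp add: ring_actionD(5)[OF assms(1)] additive_map_0[OF assms(2)])
next
  case (step1 i)
  then show ?case by (simp add: ring_actionD(1,2)[OF assms(1)] additive_mapD[OF assms(2)])
next
  case (step2 i)
  then show ?case by (simp add: ring_actionD(1,7)[OF assms(1)] additive_map_diff[OF assms(2)])
qed

text \<open>The extension of an action of \<open>R\<close> to \<open>R[X]\<close> in which \<open>X\<close> acts as \<open>h\<close>. Since \<open>X\<close> is applied to the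
  argument before the remaining coefficients act, the recursion runs through the coefficient list.\<close>

definition poly_action :: "('r::comm_ring_1 \<Rightarrow> 'a \<Rightarrow> 'a) \<Rightarrow> ('a \<Rightarrow> 'a) \<Rightarrow> 'r poly \<Rightarrow> 'a \<Rightarrow> 'a" where
  "poly_action act h p = fold_coeffs (\<lambda>c g v. act c v + g (h v)) p (\<lambda>v. 0)"

lemma poly_action_0: "poly_action act h 0 v = 0"
  by (simp add: poly_action_def)

lemma poly_action_pCons:
  assumes "ring_action act"
  shows "poly_action act h (pCons c p) v = act c v + poly_action act h p (h v)"
  by (cases "c = 0 \<and> p = 0") (auto simp: poly_action_def ring_actionD(5)[OF assms])

lemma poly_action_commute:
  assumes "ring_action act" "additive_map k" "\<And>c v. k (act c v) = act c (k v)" "\<And>v. k (h v) = h (k v)"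
  shows "k (poly_action act h p v) = poly_action act h p (k v)"
  by (induction p arbitrary: v)
    (simp_all add: poly_action_0 poly_action_pCons additive_map_0 additive_mapD assms)

lemma poly_action_mem:
  assumes "ring_action act" "additive_subgroup H" "\<And>c v. v \<in> H \<Longrightarrow> act c v \<in> H" 
    "\<And>v. v \<in> H \<Longrightarrow> h v \<in> H" "v \<in> H"
  shows "poly_action act h p v \<in> H"
  using assms(5)
proof (induction p arbitrary: v)
  case 0
  then show ?case using assms(2) by (simp add: poly_action_0 additive_subgroup_def)
next
  case (pCons a p)
  then show ?case using assms by (simp add: poly_action_pCons additive_subgroup_add)
qed

lemma poly_action_const:
  assumes "ring_action act"
  shows "poly_action act h [:c:] v = act c v"
  by (simp add: poly_action_0 poly_action_pCons assms)

lemma poly_action_X: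
  assumes "ring_action act"
  shows "poly_action act h [:0, 1:] v = h v"
  by (simp add: poly_action_0 poly_action_pCons ring_actionD[OF assms] assms)

lemma ring_action_poly_action:
  assumes A: "ring_action act" and h: "additive_map h" and comm: "\<And>c v. h (act c v) = act c (h v)"
  shows "ring_action (poly_action act h)"
proof -
  note [simp] = poly_action_0 poly_action_pCons[OF A] ring_actionD(1-3,5)[OF A]
    additive_mapD[OF ring_actionD(4)[OF A]] additive_mapD[OF h] additive_map_0[OF ring_actionD(4)[OF A]]
  have add: "poly_action act h (p + q) v = poly_action act h p v + poly_action act h q v" for p q v
    by (induction p q arbitrary: v rule: poly_induct2) (simp_all add: algebra_simps)
  have vec: "poly_action act h p (v + w) = poly_action act h p v + poly_action act h p w" for p v w
    by (induction p arbitrary: v w) (simp_all add: algebra_simps)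
  have sm: "poly_action act h (smult c p) v = act c (poly_action act h p v)" for c p v
    by (induction p arbitrary: v) simp_all
  have c: "h (poly_action act h p v) = poly_action act h p (h v)" for p v
    using poly_action_commute[of act h h, OF A h comm] by simp
  have "poly_action act h (p * q) v = poly_action act h p (poly_action act h q v)" for p q v
    by (induction p arbitrary: v) (simp_all add: add sm c)
  then show ?thesis using add vec poly_action_const[OF A, of h 1]
    by (simp add: ring_action_def additive_map_def flip: one_pCons)
qed

text \<open>Let \<open>\<int>[X, Y]\<close> act by \<open>X \<mapsto> \<tau>\<close> and \<open>Y \<mapsto> \<psi>\<close>. Simplicity of the group under \<open>\<tau>\<close>, \<open>1 - \<tau>\<close>, \<open>\<psi>\<close> and their
  inverses makes every polynomial act as zero or bijectively (Schur), so the annihilator \<open>P\<close> is prime.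
  It is a Goldman ideal with \<open>b = X (1 - X) Y\<close>: starting from \<open>v0 \<noteq> 0\<close>, fractions with denominators
  \<open>b\<^sup>n\<close> reach every element, in particular the preimage of \<open>v0\<close> under any \<open>a \<notin> P\<close>. Hence \<open>\<tau>\<inverse>\<close> is a
  polynomial in \<open>\<tau>\<close>, and every subgroup that is invariant under \<open>\<tau>\<close> is invariant under \<open>\<tau>\<inverse>\<close>.\<close>

lemma simple_without_inverse:
  assumes lam: "additive_map \<tau>" "bij \<tau>" and lam': "bij (\<lambda>v. v - \<tau> v)" and psi: "additive_map \<psi>" "bij \<psi>"
    and comm: "\<And>v. \<tau> (\<psi> v) = \<psi> (\<tau> v)"
    and simple: "\<And>H. additive_subgroup H \<Longrightarrow> (\<And>v. \<tau> v \<in> H \<longleftrightarrow> v \<in> H) \<Longrightarrow> (\<And>v. v - \<tau> v \<in> H \<longleftrightarrow> v \<in> H)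
      \<Longrightarrow> (\<And>v. \<psi> v \<in> H \<longleftrightarrow> v \<in> H) \<Longrightarrow> H = {0} \<or> H = UNIV"
    and H: "additive_subgroup H" "\<And>v. v - \<tau> v \<in> H \<longleftrightarrow> v \<in> H" "\<And>v. \<psi> v \<in> H \<longleftrightarrow> v \<in> H"
  shows "H = {0} \<or> H = UNIV"
proof (cases "\<exists>v::'a. v \<noteq> 0")
  case False
  then show ?thesis using H(1) by (auto simp: additive_subgroup_def)
next
  case True
  then obtain v0 :: 'a where v0: "v0 \<noteq> 0" by blast
  obtain act0 :: "int \<Rightarrow> 'a \<Rightarrow> 'a" where act0: "ring_action act0" using int_ring_action by blast
  define act1 where "act1 = poly_action act0 \<tau>"
  have act1: "ring_action act1"
    unfolding act1_def by (rule ring_action_poly_action[OF act0 lam(1) int_action_commute[OF act0 lam(1)]])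
  have comm1: "k (act1 p v) = act1 p (k v)" if "additive_map k" "\<And>v. k (\<tau> v) = \<tau> (k v)" for k p v
    unfolding act1_def
    using poly_action_commute[of act0 k \<tau>, OF act0 that(1) int_action_commute[OF act0 that(1)]] that(2) by blast
  define act where "act = poly_action act1 \<psi>"
  have A: "ring_action act"
    unfolding act_def by (rule ring_action_poly_action[OF act1 psi(1) comm1[OF psi(1)]]) (simp add: comm)
  note AD = ring_actionD[OF A]
  have com: "act p (act q v) = act q (act p v)" for p q v
    using AD(3)[of p q v] AD(3)[of q p v] by (simp add: mult.commute)
  define X :: "int poly poly" where "X = [:[:0, 1:]:]"
  define Y :: "int poly poly" where "Y = [:0, 1:]"
  have X: "act X v = \<tau> v" for v
    using poly_action_const[OF act1, of \<psi> "[:0, 1:]" v] poly_action_X[OF act0, of \<tau> v]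
    by (simp add: X_def act_def act1_def)
  have Y: "act Y v = \<psi> v" for v
    by (simp add: Y_def act_def poly_action_X[OF act1])
  have X': "act (1 - X) v = v - \<tau> v" for v by (simp add: AD X)
  define units where "units = {X, 1 - X, Y}"
  have units_bij: "bij (act x)" if "x \<in> units" for x
  proof -
    have "act X = \<tau>" "act (1 - X) = (\<lambda>v. v - \<tau> v)" "act Y = \<psi>"
      using X X' Y by blast+
    then show ?thesis using that lam(2) lam' psi(2) unfolding units_def by auto
  qed
  have dich: "N = {0} \<or> N = UNIV" if "additive_subgroup N" "\<And>x v. x \<in> units \<Longrightarrow> act x v \<in> N \<longleftrightarrow> v \<in> N" for N
  proof (rule simple[OF that(1)])
    show "\<tau> v \<in> N \<longleftrightarrow> v \<in> N" for v using that(2)[of X v] by (simp add: units_def X)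
    show "v - \<tau> v \<in> N \<longleftrightarrow> v \<in> N" for v using that(2)[of "1 - X" v] by (simp add: units_def X')
    show "\<psi> v \<in> N \<longleftrightarrow> v \<in> N" for v using that(2)[of Y v] by (simp add: units_def Y)
  qed
  define P where "P = {p. \<forall>v. act p v = 0}"
  have inj0: "act p v = 0 \<longleftrightarrow> v = 0" and surj0: "\<exists>w. act p w = v" if "p \<notin> P" for p v
  proof -
    have u0: "act x w = 0 \<longleftrightarrow> w = 0" if "x \<in> units" for x w
      using units_bij[OF that] additive_map_0[OF AD(4)[of x]] by (metis bij_is_inj injD)
    let ?K = "{v. act p v = 0}"
    have "?K = {0} \<or> ?K = UNIV"
    proof (rule dich)
      show "additive_subgroup ?K"
        by (auto simp: additive_subgroup_def additive_map_0[OF AD(4)] additive_map_diff[OF AD(4)])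
      show "act x v \<in> ?K \<longleftrightarrow> v \<in> ?K" if "x \<in> units" for x v using u0[OF that] com[of p x v] by simp
    qed
    then show "act p v = 0 \<longleftrightarrow> v = 0" using that by (auto simp: P_def)
    let ?I = "range (act p)"
    have "?I = {0} \<or> ?I = UNIV"
    proof (rule dich)
      show "additive_subgroup ?I"
        unfolding additive_subgroup_def
        by (auto simp flip: additive_map_diff[OF AD(4)]) (metis additive_map_0[OF AD(4)] rangeI)
      show "act x v \<in> ?I \<longleftrightarrow> v \<in> ?I" if x: "x \<in> units" for x v
      proof
        assume "act x v \<in> ?I"
        then obtain w where w: "act x v = act p w" by blast
        obtain w' where "w = act x w'" using units_bij[OF x] by (metis bij_pointE)
        then have "act x v = act x (act p w')" using w com by simp
        then have "v = act p w'" using units_bij[OF that] by (metis bij_is_inj injD)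
        then show "v \<in> ?I" by blast
      qed (use com in \<open>metis imageE rangeI\<close>)
    qed
    moreover have "\<exists>v'. act p v' \<noteq> 0" using that by (simp add: P_def)
    ultimately have "v \<in> ?I" by blast
    then show "\<exists>w. act p w = v" by force
  qed
  have P: "prime_ideal_set P"
  proof
    show "0 \<in> P" by (simp add: P_def AD)
    show "1 \<notin> P" using v0 by (auto simp: P_def AD)
    show "a + b \<in> P" if "a \<in> P" "b \<in> P" for a b using that by (simp add: P_def AD)
    show "r * a \<in> P" if "a \<in> P" for a r using that by (simp add: P_def AD additive_map_0[OF AD(4)])
    show "a \<in> P \<or> b \<in> P" if "a * b \<in> P" for a b
    proof (rule ccontr)
      assume N: "\<not> ?thesis"
      then have "act (a * b) v0 \<noteq> 0" using v0 inj0 by (simp add: AD)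
      then show False using that by (simp add: P_def)
    qed
  qed
  interpret prime_ideal_set P by (rule P)
  have units_not_P: "x \<notin> P" if "x \<in> units" for x
    using units_bij[OF that] v0 unfolding P_def by (metis (mono_tags, lifting) mem_Collect_eq bij_pointE)
  define b where "b = X * (1 - X) * Y"
  have b_P: "b \<notin> P" using prime_mem[of "X * (1 - X)" Y] prime_mem[of X "1 - X"] units_not_P
    by (auto simp: b_def units_def)
  have b_dvd: "\<exists>y. b = y * x" if "x \<in> units" for x
  proof -
    have "b = ((1 - X) * Y) * X" "b = (X * Y) * (1 - X)" "b = (X * (1 - X)) * Y"
      by (simp_all add: b_def mult_ac)
    then show ?thesis using that unfolding units_def by blast
  qed
  have "\<exists>n c. b ^ n - a * c \<in> P" if a: "a \<notin> P" for a
  proof -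
    \<comment> \<open>The submodule over the ring with \<open>b\<close> inverted that is generated by \<open>v0\<close>.\<close>
    define N where "N = {w. \<exists>n c. act (b ^ n) w = act c v0}"
    have "N = {0} \<or> N = UNIV"
    proof (rule dich)
      show "additive_subgroup N"
        unfolding additive_subgroup_def
      proof (intro conjI ballI)
        show "0 \<in> N" unfolding N_def mem_Collect_eq by (metis AD(5) additive_map_0[OF AD(4)])
        fix w w' assume "w \<in> N" "w' \<in> N"
        then obtain n c n' c' where 1: "act (b ^ n) w = act c v0" "act (b ^ n') w' = act c' v0" by (auto simp: N_def)
        have "act (b ^ (n + n')) (w - w') = act (b ^ n') (act (b ^ n) w) - act (b ^ n) (act (b ^ n') w')"
          unfolding power_add additive_map_diff[OF AD(4)] by (simp add: AD(3)) (metis com)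
        also have "\<dots> = act (b ^ n' * c - b ^ n * c') v0" by (simp add: 1 AD)
        finally show "w - w' \<in> N" by (auto simp: N_def)
      qed
      show "act x w \<in> N \<longleftrightarrow> w \<in> N" if "x \<in> units" for x w
      proof
        assume "act x w \<in> N"
        then obtain n c where "act (b ^ n) (act x w) = act c v0" by (auto simp: N_def)
        moreover obtain y where "b = y * x" using b_dvd[OF \<open>x \<in> units\<close>] by blast
        ultimately have "act (b ^ Suc n) w = act (y * c) v0"
          using com[of "b ^ n"] by (simp add: AD)
        then show "w \<in> N" unfolding N_def by blast
      next
        assume "w \<in> N"
        then obtain n c where "act (b ^ n) w = act c v0" by (auto simp: N_def)
        then have "act (b ^ n) (act x w) = act (x * c) v0" using com[of "b ^ n"] by (simp add: AD)
        then show "act x w \<in> N" unfolding N_def by blast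
      qed
    qed
    moreover have "v0 \<in> N" unfolding N_def by blast
    ultimately have "N = UNIV" using v0 by blast
    obtain w where w: "act a w = v0" using surj0[OF a] by blast
    have "w \<in> N" using \<open>N = UNIV\<close> by simp
    then obtain n c where nc: "act (b ^ n) w = act c v0" by (auto simp: N_def)
    have "act (b ^ n - a * c) v0 = act a (act (b ^ n) w) - act a (act c v0)"
      using com[of "b ^ n" a w] by (simp add: AD w)
    then have "act (b ^ n - a * c) v0 = 0" by (simp add: nc)
    then have "b ^ n - a * c \<in> P" using inj0 v0 by blast
    then show ?thesis by blast
  qed
  then have "goldman P" using b_P by (auto simp: goldman_def)
  moreover have "[:[:0, 1:]:] \<notin> P" using units_not_P[of X] by (simp add: units_def X_def)
  ultimately obtain h where h: "[:[:0, 1:] * h - 1:] \<in> P" using goldman_int_poly_poly[OF P] by blast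
  have inv: "\<tau> (act1 h v) = v" for v
  proof -
    have "act [:[:0, 1:] * h - 1:] v = 0" using h by (simp add: P_def)
    then have "act1 ([:0, 1:] * h) v - v = 0"
      unfolding act_def poly_action_const[OF act1] by (simp only: ring_actionD[OF act1])
    then show ?thesis unfolding ring_actionD(3)[OF act1] by (simp add: act1_def poly_action_X[OF act0])
  qed
  have lamH: "\<tau> v \<in> H" if "v \<in> H" for v
  proof -
    have "v - (v - \<tau> v) \<in> H" using that H(1,2) unfolding additive_subgroup_def by blast
    then show ?thesis by (simp add: algebra_simps)
  qed
  have act0H: "act0 k v \<in> H" if "v \<in> H" for k v
  proof (induction k rule: int_induct[of _ 0])
    case base
    then show ?case using H(1) by (simp add: ring_actionD[OF act0] additive_subgroup_def)
  next
    case (step1 i)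
    then show ?case using that by (simp add: ring_actionD[OF act0] additive_subgroup_add[OF H(1)])
  next
    case (step2 i)
    then show ?case using that H(1) by (simp add: ring_actionD[OF act0] additive_subgroup_def)
  qed
  have lamH': "v \<in> H" if "\<tau> v \<in> H" for v
  proof -
    have "act1 h (\<tau> v) \<in> H" unfolding act1_def
      by (rule poly_action_mem[OF act0 H(1) act0H lamH that])
    then show ?thesis using inv comm1[OF lam(1) refl, of h v] by simp
  qed
  show ?thesis
  proof (rule simple[OF H(1) _ H(2,3)])
    show "\<tau> v \<in> H \<longleftrightarrow> v \<in> H" for v using lamH lamH' by blast
  qed
qed

end

section \<open>F-quasigroups and their left regular permutations\<close>

abbreviation "pinv \<equiv> inv_into UNIV"

lemma bij_conjugate:
  assumes "bij p" "bij c" "\<And>y. p (k y) = c (p y)"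
  shows "bij k"
proof -
  have "k = pinv p \<circ> c \<circ> p"
    using assms(1) by (auto simp: fun_eq_iff bij_is_inj inv_f_f simp flip: assms(3))
  then show ?thesis using assms(1,2) by (simp add: bij_comp bij_imp_bij_inv)
qed

lemma bij_conjugate_inv:
  assumes "bij p" "bij c" "\<And>y. k (p y) = p (c y)"
  shows "bij k"
proof -
  have "k = p \<circ> c \<circ> pinv p"
    using assms(1) by (auto simp: fun_eq_iff bij_is_surj surj_f_inv_f simp flip: assms(3))
  then show ?thesis using assms(1,2) by (simp add: bij_comp bij_imp_bij_inv)
qed

text \<open>A normal congruence is an equivalence relation that is invariant under all translations and
  their inverses.\<close>

lemma normal_congruence_iff:
  "normal_congruence m \<theta> \<longleftrightarrow> equiv UNIV \<theta> \<and>
     (\<forall>x y z. (m z x, m z y) \<in> \<theta> \<longleftrightarrow> (x, y) \<in> \<theta>) \<and>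
     (\<forall>x y z. (m x z, m y z) \<in> \<theta> \<longleftrightarrow> (x, y) \<in> \<theta>)"
  unfolding normal_congruence_def congruence_def
  by (rule iffI; elim conjE; intro conjI allI iffI impI; meson)

locale F_quasi =
  fixes m :: "'a \<Rightarrow> 'a \<Rightarrow> 'a" (infixl "\<cdot>" 70)
  assumes F_quasigroup: "F_quasigroup m"
begin

abbreviation "e \<equiv> e_map m"
abbreviation "f \<equiv> f_map m"

lemma quasigroup: "quasigroup m"
  using F_quasigroup by (simp add: F_quasigroup_def)

lemma left_cancel [simp]: "a \<cdot> x = a \<cdot> y \<longleftrightarrow> x = y"
  using quasigroup unfolding quasigroup_def by metis

lemma right_cancel [simp]: "x \<cdot> a = y \<cdot> a \<longleftrightarrow> x = y"
  using quasigroup unfolding quasigroup_def by metis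

lemma left_div: obtains x where "b = a \<cdot> x"
  using quasigroup unfolding quasigroup_def by metis

lemma right_div: obtains x where "b = x \<cdot> a"
  using quasigroup unfolding quasigroup_def by metis

lemma bij_left: "bij (\<lambda>x. a \<cdot> x)"
  unfolding bij_iff using quasigroup unfolding quasigroup_def by blast

lemma bij_right: "bij (\<lambda>x. x \<cdot> a)"
  unfolding bij_iff using quasigroup unfolding quasigroup_def by blast

lemma left_solution: obtains t where "\<And>u. a \<cdot> t u = b u"
  using that[of "\<lambda>u. pinv (\<lambda>x. a \<cdot> x) (b u)"] surj_f_inv_f[OF bij_is_surj[OF bij_left]] by simp

lemma right_solution: obtains t where "\<And>u. t u \<cdot> a = b u"
  using that[of "\<lambda>u. pinv (\<lambda>x. x \<cdot> a) (b u)"] surj_f_inv_f[OF bij_is_surj[OF bij_right]] by simp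

lemma e_right [simp]: "x \<cdot> e x = x"
  using e_map_unique[OF quasigroup] by blast

lemma f_left [simp]: "f x \<cdot> x = x"
  using f_map_unique[OF quasigroup] by blast

lemma left_F: "x \<cdot> (y \<cdot> z) = (x \<cdot> y) \<cdot> (e x \<cdot> z)"
  using F_quasigroup unfolding F_quasigroup_def by blast

lemma right_F: "(x \<cdot> y) \<cdot> z = (x \<cdot> f z) \<cdot> (y \<cdot> z)"
  using F_quasigroup unfolding F_quasigroup_def by blast

lemma e_hom: "e (x \<cdot> y) = e x \<cdot> e y"
  using left_F[of x y "e y"] e_map_unique[OF quasigroup, of "x \<cdot> y" "e x \<cdot> e y"] by simp

lemma f_hom: "f (x \<cdot> y) = f x \<cdot> f y"
proof -
  have "(f x \<cdot> x) \<cdot> y = (f x \<cdot> f y) \<cdot> (x \<cdot> y)" by (rule right_F)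
  then show ?thesis using f_map_unique[OF quasigroup, of "f x \<cdot> f y" "x \<cdot> y"] by simp
qed

lemma endomorphism_e: "endomorphism m e" and endomorphism_f: "endomorphism m f"
  by (simp_all add: endomorphism_def e_hom f_hom)

lemma normal_congruenceI:
  assumes "equiv UNIV \<theta>" "\<And>x y z. (z \<cdot> x, z \<cdot> y) \<in> \<theta> \<longleftrightarrow> (x, y) \<in> \<theta>"
    "\<And>x y z. (x \<cdot> z, y \<cdot> z) \<in> \<theta> \<longleftrightarrow> (x, y) \<in> \<theta>"
  shows "normal_congruence m \<theta>"
  using assms by (simp add: normal_congruence_iff)

lemma kernel_normal:
  assumes "endomorphism m h"
  shows "normal_congruence m {(x, y). h x = h y}"
  using assms by (intro normal_congruenceI) (auto simp: endomorphism_def equiv_def refl_on_def sym_def trans_def)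

lemma simple_endo_cases:
  assumes "simple_quasigroup m" "endomorphism m h"
  shows "inj h \<or> zero_endomorphism m h"
proof -
  have "{(x, y). h x = h y} = Id \<or> {(x, y). h x = h y} = UNIV"
    using assms kernel_normal unfolding simple_quasigroup_def by blast
  then show ?thesis
  proof
    assume "{(x, y). h x = h y} = Id"
    then have "inj h" unfolding inj_def by blast
    then show ?thesis ..
  next
    assume "{(x, y). h x = h y} = UNIV"
    then have "h x = h y" for x y by blast
    then show ?thesis using assms(2) unfolding zero_endomorphism_def by blast
  qed
qed

text \<open>Both conditions say that the quasigroup is idempotent.\<close>

lemma e_id_iff_f_id: "e = id \<longleftrightarrow> f = id"
  unfolding fun_eq_iff id_apply
  using e_map_unique[OF quasigroup] f_map_unique[OF quasigroup] by metis

lemma e_map_dual: "e_map (\<lambda>x y. y \<cdot> x) = f" and f_map_dual: "f_map (\<lambda>x y. y \<cdot> x) = e"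
  by (simp_all add: e_map_def[abs_def] f_map_def[abs_def])

lemma F_quasi_dual: "F_quasi (\<lambda>x y. y \<cdot> x)"
proof
  have q: "quasigroup (\<lambda>x y. y \<cdot> x)" using quasigroup by (simp add: quasigroup_def)
  then show "F_quasigroup (\<lambda>x y. y \<cdot> x)"
    using right_F left_F unfolding F_quasigroup_def e_map_dual f_map_dual by blast
qed

text \<open>The condition says that \<open>(id, c', c)\<close> is an autotopism, or that all maps \<open>L\<^sub>x\<inverse> c L\<^sub>x\<close> are the same.
  The companion \<open>c'\<close> is determined by \<open>c\<close> and automatically bijective.\<close>

definition left_regular :: "('a \<Rightarrow> 'a) \<Rightarrow> bool" where
  "left_regular c \<longleftrightarrow> bij c \<and> (\<exists>c'. \<forall>x u. c (x \<cdot> u) = x \<cdot> c' u)"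

lemma left_regular_id: "left_regular id"
  unfolding left_regular_def by (auto intro: exI[of _ id])

lemma left_regular_comp:
  assumes "left_regular c" "left_regular d"
  shows "left_regular (c \<circ> d)"
proof -
  obtain c' d' where "\<And>x u. c (x \<cdot> u) = x \<cdot> c' u" "\<And>x u. d (x \<cdot> u) = x \<cdot> d' u"
    using assms unfolding left_regular_def by blast
  then have "\<forall>x u. (c \<circ> d) (x \<cdot> u) = x \<cdot> (c' \<circ> d') u" by simp
  then show ?thesis using assms bij_comp unfolding left_regular_def by blast
qed

lemma left_regular_inv:
  assumes "left_regular c"
  shows "left_regular (pinv c)"
proof -
  obtain c' where c': "\<And>x u. c (x \<cdot> u) = x \<cdot> c' u" and c: "bij c"
    using assms unfolding left_regular_def by blast
  have "pinv c (x \<cdot> u) = x \<cdot> pinv c' u" for x u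
  proof -
    obtain v where v: "pinv c (x \<cdot> u) = x \<cdot> v" by (rule left_div)
    have c'v: "c' v = u" using c' v c by (metis bij_inv_eq_iff left_cancel)
    have "inj c'" using c' c by (metis bij_is_inj injD injI left_cancel)
    then show ?thesis using v c'v by (metis inv_f_f)
  qed
  then show ?thesis using c bij_imp_bij_inv unfolding left_regular_def by blast
qed

text \<open>The next four lemmas state that conjugation by a translation or its inverse preserves left
  regularity. For left translations this is the left law: it gives \<open>L\<^sub>a L\<^sub>x = L\<^sub>a\<^sub>x L\<^sub>e\<^sub>a\<close>, so
  conjugation by \<open>L\<^sub>a\<close> sends \<open>L\<^sub>x L\<^sub>y\<inverse>\<close> to \<open>L\<^sub>a\<^sub>x L\<^sub>a\<^sub>y\<inverse>\<close>. For right translations it is the right law,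
  which says that \<open>R\<^sub>a\<close> is the last component of the autotopism \<open>(R\<^sub>f\<^sub>a, R\<^sub>a, R\<^sub>a)\<close>.\<close>

lemma left_regular_div_left:
  assumes "left_regular c"
  obtains k where "left_regular k" "\<And>y. a \<cdot> k y = c (a \<cdot> y)"
proof -
  obtain k where k: "\<And>x u. c (x \<cdot> u) = x \<cdot> k u" and c: "bij c"
    using assms unfolding left_regular_def by blast
  obtain t where t: "\<And>u. e a \<cdot> t u = k (e a \<cdot> u)"
    using left_solution[of "e a" "\<lambda>u. k (e a \<cdot> u)"] by blast
  have "k (x \<cdot> u) = x \<cdot> t u" for x u
  proof -
    have "a \<cdot> k (x \<cdot> u) = c ((a \<cdot> x) \<cdot> (e a \<cdot> u))" by (simp only: left_F[of a x u, symmetric] k)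
    also have "\<dots> = (a \<cdot> x) \<cdot> (e a \<cdot> t u)" by (simp only: k t)
    also have "\<dots> = a \<cdot> (x \<cdot> t u)" by (rule left_F[symmetric])
    finally show ?thesis by simp
  qed
  moreover have "bij k" by (rule bij_conjugate[OF bij_left[of a] c]) (simp add: k)
  ultimately have "left_regular k" unfolding left_regular_def by blast
  then show thesis by (rule that) (simp add: k)
qed

lemma left_regular_mult_left:
  assumes "left_regular c"
  obtains k where "left_regular k" "\<And>y. k (a \<cdot> y) = a \<cdot> c y"
proof -
  obtain c' where c': "\<And>x u. c (x \<cdot> u) = x \<cdot> c' u" and c: "bij c"
    using assms unfolding left_regular_def by blast
  define k where "k z = a \<cdot> c (pinv (\<lambda>y. a \<cdot> y) z)" for z
  have k: "k (a \<cdot> y) = a \<cdot> c y" for y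
    unfolding k_def by (simp add: bij_is_inj[OF bij_left] inv_f_f)
  define k' where "k' z = e a \<cdot> c' (pinv (\<lambda>y. e a \<cdot> y) z)" for z
  have k': "k' (e a \<cdot> y) = e a \<cdot> c' y" for y
    unfolding k'_def by (simp add: bij_is_inj[OF bij_left] inv_f_f)
  have "k (z \<cdot> u) = z \<cdot> k' u" for z u
  proof -
    obtain x where x: "z = a \<cdot> x" by (rule left_div)
    obtain u' where u: "u = e a \<cdot> u'" by (rule left_div)
    have "k (z \<cdot> u) = a \<cdot> (x \<cdot> c' u')" by (simp only: x u k c' left_F[symmetric])
    also have "\<dots> = z \<cdot> k' u" by (simp only: x u k' left_F[of a x "c' u'"])
    finally show ?thesis .
  qed
  moreover have "bij k" by (rule bij_conjugate_inv[OF bij_left[of a] c]) (rule k)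
  ultimately have "left_regular k" unfolding left_regular_def by blast
  then show thesis by (rule that) (rule k)
qed

lemma left_regular_div_right:
  assumes "left_regular c"
  obtains k where "left_regular k" "\<And>y. k y \<cdot> a = c (y \<cdot> a)"
proof -
  obtain c' where c': "\<And>x u. c (x \<cdot> u) = x \<cdot> c' u" and c: "bij c"
    using assms unfolding left_regular_def by blast
  obtain k where k: "\<And>u. k u \<cdot> a = c (u \<cdot> a)"
    using right_solution[of a "\<lambda>u. c (u \<cdot> a)"] by blast
  obtain k' where k': "\<And>u. k' u \<cdot> a = c' (u \<cdot> a)"
    using right_solution[of a "\<lambda>u. c' (u \<cdot> a)"] by blast
  have "k (x \<cdot> u) = x \<cdot> k' u" for x u
  proof -
    have "k (x \<cdot> u) \<cdot> a = (x \<cdot> f a) \<cdot> (k' u \<cdot> a)" by (simp only: k right_F[of x u] c' k')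
    also have "\<dots> = (x \<cdot> k' u) \<cdot> a" by (rule right_F[symmetric])
    finally show ?thesis by simp
  qed
  moreover have "bij k" by (rule bij_conjugate[OF bij_right[of a] c]) (rule k)
  ultimately have "left_regular k" unfolding left_regular_def by blast
  then show thesis by (rule that) (rule k)
qed

lemma left_regular_mult_right:
  assumes "left_regular c"
  obtains k where "left_regular k" "\<And>y. k (y \<cdot> a) = c y \<cdot> a"
proof -
  obtain c' where c': "\<And>x u. c (x \<cdot> u) = x \<cdot> c' u" and c: "bij c"
    using assms unfolding left_regular_def by blast
  define g where "g h z = h (pinv (\<lambda>y. y \<cdot> a) z) \<cdot> a" for h z
  have g: "g h (y \<cdot> a) = h y \<cdot> a" for h y
    unfolding g_def using inv_f_f[OF bij_is_inj[OF bij_right], of a y] by simp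
  have "g c (z \<cdot> w) = z \<cdot> g c' w" for z w
  proof -
    obtain x where x: "z = x \<cdot> f a" by (rule right_div)
    obtain u where u: "w = u \<cdot> a" by (rule right_div)
    have "g c (z \<cdot> w) = (x \<cdot> c' u) \<cdot> a" by (simp only: x u g c' right_F[symmetric])
    also have "\<dots> = z \<cdot> g c' w" by (simp only: x u g right_F[of x "c' u" a])
    finally show ?thesis .
  qed
  moreover have "bij (g c)" by (rule bij_conjugate_inv[OF bij_right[of a] c]) (rule g)
  ultimately have "left_regular (g c)" unfolding left_regular_def by blast
  then show thesis by (rule that) (rule g)
qed

definition regular_orbits :: "('a \<times> 'a) set" where
  "regular_orbits = {(x, y). \<exists>c. left_regular c \<and> c x = y}"

lemma regular_orbitsI: "left_regular c \<Longrightarrow> c x = y \<Longrightarrow> (x, y) \<in> regular_orbits"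
  by (auto simp: regular_orbits_def)

lemma regular_orbitsE:
  assumes "(x, y) \<in> regular_orbits"
  obtains c where "left_regular c" "c x = y"
  using assms by (auto simp: regular_orbits_def)

lemma regular_orbits_normal: "normal_congruence m regular_orbits"
proof (rule normal_congruenceI)
  show "equiv UNIV regular_orbits"
  proof (rule equivI)
    show "refl_on UNIV regular_orbits"
      using left_regular_id by (auto simp: refl_on_def regular_orbits_def)
    show "sym regular_orbits"
    proof (rule symI)
      fix x y assume "(x, y) \<in> regular_orbits"
      then obtain c where c: "left_regular c" "c x = y" by (rule regular_orbitsE)
      show "(y, x) \<in> regular_orbits"
        by (rule regular_orbitsI[OF left_regular_inv[OF c(1)]])
          (use c in \<open>auto simp: left_regular_def bij_is_inj\<close>)
    qed
    show "trans regular_orbits"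
    proof (rule transI)
      fix x y z assume "(x, y) \<in> regular_orbits" "(y, z) \<in> regular_orbits"
      then obtain c d where cd: "left_regular c" "c x = y" "left_regular d" "d y = z"
        by (auto elim!: regular_orbitsE)
      show "(x, z) \<in> regular_orbits"
        by (rule regular_orbitsI[OF left_regular_comp[OF cd(3,1)]]) (simp add: cd)
    qed
  qed simp
  show "(z \<cdot> x, z \<cdot> y) \<in> regular_orbits \<longleftrightarrow> (x, y) \<in> regular_orbits" for x y z
  proof
    assume "(z \<cdot> x, z \<cdot> y) \<in> regular_orbits"
    then obtain c where c: "left_regular c" "c (z \<cdot> x) = z \<cdot> y" by (rule regular_orbitsE)
    obtain k where k: "left_regular k" "\<And>v. z \<cdot> k v = c (z \<cdot> v)" using left_regular_div_left[OF c(1), of z] by metis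
    show "(x, y) \<in> regular_orbits" by (rule regular_orbitsI[OF k(1)]) (use k(2) c(2) in \<open>metis left_cancel right_cancel\<close>)
  next
    assume "(x, y) \<in> regular_orbits"
    then obtain c where c: "left_regular c" "c x = y" by (rule regular_orbitsE)
    obtain k where k: "left_regular k" "\<And>v. k (z \<cdot> v) = z \<cdot> c v" using left_regular_mult_left[OF c(1), of z] by metis
    show "(z \<cdot> x, z \<cdot> y) \<in> regular_orbits" by (rule regular_orbitsI[OF k(1)]) (use k(2) c(2) in \<open>metis left_cancel right_cancel\<close>)
  qed
  show "(x \<cdot> z, y \<cdot> z) \<in> regular_orbits \<longleftrightarrow> (x, y) \<in> regular_orbits" for x y z
  proof
    assume "(x \<cdot> z, y \<cdot> z) \<in> regular_orbits"
    then obtain c where c: "left_regular c" "c (x \<cdot> z) = y \<cdot> z" by (rule regular_orbitsE)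
    obtain k where k: "left_regular k" "\<And>v. k v \<cdot> z = c (v \<cdot> z)" using left_regular_div_right[OF c(1), of z] by metis
    show "(x, y) \<in> regular_orbits" by (rule regular_orbitsI[OF k(1)]) (use k(2) c(2) in \<open>metis left_cancel right_cancel\<close>)
  next
    assume "(x, y) \<in> regular_orbits"
    then obtain c where c: "left_regular c" "c x = y" by (rule regular_orbitsE)
    obtain k where k: "left_regular k" "\<And>v. k (v \<cdot> z) = c v \<cdot> z" using left_regular_mult_right[OF c(1), of z] by metis
    show "(x \<cdot> z, y \<cdot> z) \<in> regular_orbits" by (rule regular_orbitsI[OF k(1)]) (use k(2) c(2) in \<open>metis left_cancel right_cancel\<close>)
  qed
qed

text \<open>Left regularity is defined from the operation alone.\<close>

lemma regular_orbits_automorphism: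
  assumes "automorphism m h" "(x, y) \<in> regular_orbits"
  shows "(h x, h y) \<in> regular_orbits"
proof -
  obtain c c' where c: "\<And>x u. c (x \<cdot> u) = x \<cdot> c' u" "bij c" "c x = y"
    using assms(2) unfolding regular_orbits_def left_regular_def by blast
  have h: "bij h" "\<And>u v. h (u \<cdot> v) = h u \<cdot> h v"
    using assms(1) by (auto simp: automorphism_def endomorphism_def)
  have hi: "h (pinv h u) = u" "pinv h (h u) = u" for u
    using h(1) by (simp_all add: bij_is_surj surj_f_inv_f bij_is_inj)
  have ih: "pinv h (u \<cdot> v) = pinv h u \<cdot> pinv h v" for u v
    by (metis h(2) hi)
  have "(h \<circ> c \<circ> pinv h) (u \<cdot> v) = u \<cdot> (h \<circ> c' \<circ> pinv h) v" for u v
    by (simp add: ih c(1) h(2) hi)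
  moreover have "bij (h \<circ> c \<circ> pinv h)" using c(2) h(1) by (simp add: bij_comp bij_imp_bij_inv)
  ultimately have "left_regular (h \<circ> c \<circ> pinv h)" unfolding left_regular_def by blast
  moreover have "(h \<circ> c \<circ> pinv h) (h x) = h y" using c(3) hi by simp
  ultimately show ?thesis unfolding regular_orbits_def by blast
qed

lemma automorphism_inv:
  assumes "automorphism m h"
  shows "automorphism m (pinv h)"
  using assms unfolding automorphism_def endomorphism_def
  by (metis bij_imp_bij_inv bij_inv_eq_iff)

lemma regular_orbits_e:
  assumes "bij e"
  shows "(e x, e y) \<in> regular_orbits \<longleftrightarrow> (x, y) \<in> regular_orbits"
proof -
  have "automorphism m e" using assms endomorphism_e by (simp add: automorphism_def)
  then show ?thesis
    using regular_orbits_automorphism[of e x y] regular_orbits_automorphism[of "pinv e" "e x" "e y"]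
      automorphism_inv assms by (auto simp: bij_is_inj)
qed

text \<open>The left law is the autotopism \<open>(L\<^sub>x, L\<^sub>e\<^sub>x, L\<^sub>x)\<close>, the right law the autotopism \<open>(R\<^sub>f\<^sub>z, R\<^sub>z, R\<^sub>z)\<close>, and
  \<open>R\<^sub>z L\<^sub>x R\<^sub>z\<inverse> = L\<^sub>x\<^sub>f\<^sub>z\<close>. The identity is the conjugate of the first autotopism by the second one.\<close>

lemma shifted_autotopism: "(x \<cdot> f z) \<cdot> (u \<cdot> v) = ((x \<cdot> f (f z)) \<cdot> u) \<cdot> ((e x \<cdot> f z) \<cdot> v)"
proof -
  obtain v' where v: "v = v' \<cdot> z" by (rule right_div)
  obtain u' where u: "u = u' \<cdot> f z" by (rule right_div)
  have "(x \<cdot> f z) \<cdot> (u \<cdot> v) = (x \<cdot> (u' \<cdot> v')) \<cdot> z" by (simp only: u v right_F[symmetric])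
  also have "\<dots> = ((x \<cdot> u') \<cdot> (e x \<cdot> v')) \<cdot> z" by (simp only: left_F[of x u' v'])
  also have "\<dots> = ((x \<cdot> u') \<cdot> f z) \<cdot> ((e x \<cdot> v') \<cdot> z)" by (rule right_F)
  also have "\<dots> = ((x \<cdot> f (f z)) \<cdot> (u' \<cdot> f z)) \<cdot> ((e x \<cdot> f z) \<cdot> (v' \<cdot> z))"
    by (simp only: right_F[of x u' "f z"] right_F[of "e x" v' z])
  finally show ?thesis by (simp only: u v)
qed

text \<open>Put \<open>a = x \<cdot> f(f x)\<close>. The shifted autotopism and the autotopism \<open>(L\<^sub>a, L\<^sub>e\<^sub>a, L\<^sub>a)\<close> have the same first
  component. Their quotient has first component the identity, so its last component
  \<open>L\<^sub>a\<inverse> L\<^sub>b\<close>, where \<open>b = x \<cdot> f x\<close>, is left regular. When the orbits are trivial this forces \<open>a = b\<close>.\<close>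

lemma regular_orbits_trivial:
  assumes "regular_orbits = Id"
  shows "f (f x) = f x"
proof -
  obtain c where c: "\<And>v. (x \<cdot> f (f x)) \<cdot> c v = (x \<cdot> f x) \<cdot> v"
    using left_solution[of "x \<cdot> f (f x)" "\<lambda>v. (x \<cdot> f x) \<cdot> v"] by blast
  obtain c' where c': "\<And>v. e (x \<cdot> f (f x)) \<cdot> c' v = (e x \<cdot> f x) \<cdot> v"
    using left_solution[of "e (x \<cdot> f (f x))" "\<lambda>v. (e x \<cdot> f x) \<cdot> v"] by blast
  have "c (u \<cdot> v) = u \<cdot> c' v" for u v
  proof -
    have "(x \<cdot> f (f x)) \<cdot> c (u \<cdot> v) = (x \<cdot> f (f x)) \<cdot> (u \<cdot> c' v)"
      unfolding c left_F[of "x \<cdot> f (f x)" u "c' v"] c' by (rule shifted_autotopism)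
    then show ?thesis by simp
  qed
  moreover have "bij c"
  proof -
    have "c = pinv (\<lambda>y. (x \<cdot> f (f x)) \<cdot> y) \<circ> (\<lambda>y. (x \<cdot> f x) \<cdot> y)"
      by (rule ext) (simp add: bij_is_inj[OF bij_left] inv_f_f flip: c)
    then show ?thesis using bij_left bij_comp bij_imp_bij_inv by metis
  qed
  ultimately have "left_regular c" unfolding left_regular_def by blast
  then have "c x = x" using assms unfolding regular_orbits_def by blast
  then show ?thesis using c[of x] by simp
qed

end

section \<open>F-quasigroups that are linear over a group\<close>

lemma group_add_of_group:
  assumes "Group.group (on_UNIV add zro)"
  obtains sub neg where "class.group_add sub add zro neg"
proof -
  interpret Group.group "on_UNIV add zro" by fact
  have as: "add (add x y) z = add x (add y z)" for x y z using m_assoc[of x y z] by simp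
  have un: "add zro x = x" "add x zro = x" for x using l_one[of x] r_one[of x] by simp_all
  have li: "add (m_inv (on_UNIV add zro) x) x = zro" for x using l_inv[of x] by simp
  show thesis
    by (rule that[of "\<lambda>x y. add x (m_inv (on_UNIV add zro) y)" "m_inv (on_UNIV add zro)"],
        unfold_locales) (simp_all add: as un li)
qed

context group_add
begin

lemma group_on_UNIV: "Group.group (on_UNIV (+) 0)"
proof (rule groupI)
  fix x :: 'a
  show "\<exists>y\<in>carrier (on_UNIV (+) 0). y \<otimes>\<^bsub>on_UNIV (+) 0\<^esub> x = \<one>\<^bsub>on_UNIV (+) 0\<^esub>"
    using left_minus[of x] by (auto intro: exI[of _ "- x"])
qed (simp_all add: add.assoc)

definition linear_over :: "('a \<Rightarrow> 'a \<Rightarrow> 'a) \<Rightarrow> ('a \<Rightarrow> 'a) \<Rightarrow> ('a \<Rightarrow> 'a) \<Rightarrow> 'a \<Rightarrow> bool" where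
  "linear_over m \<phi> \<psi> c \<longleftrightarrow> additive_map \<phi> \<and> bij \<phi> \<and> additive_map \<psi> \<and> bij \<psi> \<and>
     (\<forall>x y. m x y = \<phi> x + c + \<psi> y)"

text \<open>The constant \<open>c\<close> enters the left translations only through a conjugation, so normality of \<open>H\<close>
  absorbs it.\<close>

lemma coset_congruence:
  assumes m: "linear_over m \<phi> \<psi> c" and H: "additive_subgroup H"
    and normal: "\<And>g h. h \<in> H \<Longrightarrow> g + h - g \<in> H"
    and inv: "\<And>h. \<phi> h \<in> H \<longleftrightarrow> h \<in> H" "\<And>h. \<psi> h \<in> H \<longleftrightarrow> h \<in> H"
  shows "normal_congruence m {(x, y). x - y \<in> H}"
proof -
  have mx: "m x y = \<phi> x + c + \<psi> y" and add: "additive_map \<phi>" "additive_map \<psi>" for x y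
    using m by (simp_all add: linear_over_def)
  \<comment> \<open>A normal congruence also needs the converse implications, that is, conjugation by \<open>-g\<close>.\<close>
  have normal': "g + h - g \<in> H \<longleftrightarrow> h \<in> H" for g h
  proof
    assume "g + h - g \<in> H"
    then have "- g + (g + h - g) - (- g) \<in> H" by (rule normal)
    moreover have "- g + (g + h - g) - (- g) = h" by (simp add: algebra_simps)
    ultimately show "h \<in> H" by simp
  qed (rule normal)
  have "equiv UNIV {(x, y). x - y \<in> H}"
  proof (rule equivI)
    show "refl_on UNIV {(x, y). x - y \<in> H}"
      using H by (auto simp: refl_on_def additive_subgroup_def)
    show "sym {(x, y). x - y \<in> H}"
      using additive_subgroup_minus[OF H] by (auto simp: sym_def) (metis minus_diff_eq)
    show "trans {(x, y). x - y \<in> H}"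
      using additive_subgroup_add[OF H] by (auto simp: trans_def) (metis add_diff_eq diff_add_cancel)
  qed simp
  moreover have "(m z x, m z y) \<in> {(x, y). x - y \<in> H} \<longleftrightarrow> (x, y) \<in> {(x, y). x - y \<in> H}" for x y z
  proof -
    have "m z x - m z y = (\<phi> z + c) + \<psi> (x - y) - (\<phi> z + c)"
      by (simp add: mx additive_map_diff[OF add(2)] algebra_simps)
    then show ?thesis by (simp add: normal' inv)
  qed
  moreover have "(m x z, m y z) \<in> {(x, y). x - y \<in> H} \<longleftrightarrow> (x, y) \<in> {(x, y). x - y \<in> H}" for x y z
  proof -
    have "m x z - m y z = \<phi> (x - y)"
    proof -
      have "a + k - (b + k) = a - b" for a b k :: 'a
        by (simp only: diff_add_eq_diff_diff_swap add_diff_cancel)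
      then show ?thesis unfolding mx add.assoc additive_map_diff[OF add(1)] .
    qed
    then show ?thesis by (simp add: inv)
  qed
  ultimately show ?thesis unfolding normal_congruence_def congruence_def by blast
qed

definition center :: "'a set" where
  "center = {h. \<forall>g. g + h = h + g}"

lemma center_congruence:
  assumes m: "linear_over m \<phi> \<psi> c"
  shows "normal_congruence m {(x, y). x - y \<in> center}"
proof (rule coset_congruence[OF m])
  show "additive_subgroup center"
    unfolding additive_subgroup_def center_def
    by auto (metis add.assoc add_diff_eq diff_add_cancel)
  show "g + h - g \<in> center" if "h \<in> center" for g h
    using that by (simp add: center_def)
  have aut: "\<alpha> h \<in> center \<longleftrightarrow> h \<in> center" if \<alpha>: "additive_map \<alpha>" "bij \<alpha>" for \<alpha> h
  proof -
    have "(\<forall>g. g + \<alpha> h = \<alpha> h + g) \<longleftrightarrow> (\<forall>g. \<alpha> g + \<alpha> h = \<alpha> h + \<alpha> g)"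
      using \<alpha>(2) by (metis bij_pointE)
    also have "\<dots> \<longleftrightarrow> (\<forall>g. g + h = h + g)"
      using \<alpha> by (simp flip: additive_mapD add: bij_is_inj inj_eq)
    finally show ?thesis by (simp add: center_def)
  qed
  show "\<phi> h \<in> center \<longleftrightarrow> h \<in> center" "\<psi> h \<in> center \<longleftrightarrow> h \<in> center" for h
    using aut m by (simp_all add: linear_over_def)
qed

lemma linear_f_map:
  assumes "F_quasi m" "linear_over m \<phi> \<psi> c"
  shows "\<phi> (f_map m x) = x - \<psi> x - c"
proof -
  interpret F_quasi m by fact
  have "m x y = \<phi> x + c + \<psi> y" for x y using assms(2) by (simp add: linear_over_def)
  then have "\<phi> (f x) + c + \<psi> x = x" using f_left[of x] by metis
  then have "\<phi> (f x) + c = x - \<psi> x" by (metis add_diff_cancel)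
  then show ?thesis by (metis add_diff_cancel)
qed

text \<open>Cancelling equal summands in the right law leaves an identity in two variables \<open>y\<close> and \<open>z\<close>. Setting
  \<open>y = 0\<close> expresses \<open>f z\<close>, setting \<open>z = 0\<close> compares \<open>\<phi> \<psi>\<close> with \<open>\<psi> \<phi>\<close>; substituting both back shows that
  \<open>t = \<psi> z\<close> and \<open>\<psi> t\<close> conjugate an arbitrary element in the same way.\<close>

lemma linear_F_identities:
  assumes "F_quasi m" "linear_over m \<phi> \<psi> c"
  shows "\<phi> (\<psi> y) + c = c - \<psi> c + \<psi> (\<phi> y) + \<psi> c" and "t - \<psi> t \<in> center"
proof -
  interpret F_quasi m by fact
  have mx: "m x y = \<phi> x + c + \<psi> y" and add: "additive_map \<phi>" "additive_map \<psi>" and "bij \<phi>" "bij \<psi>" for x y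
    using assms(2) by (simp_all add: linear_over_def)
  note [simp] = additive_mapD[OF add(1)] additive_mapD[OF add(2)] additive_map_0[OF add(1)] additive_map_0[OF add(2)]
  have A: "\<phi> (\<psi> y) + (c + \<psi> z) = \<phi> (\<psi> (f z)) + (c + (\<psi> (\<phi> y) + (\<psi> c + \<psi> (\<psi> z))))" for y z
    using right_F[of 0 y z] unfolding mx by (simp add: add.assoc)
  have K: "\<phi> (\<psi> (f z)) + c = c + \<psi> z - \<psi> (\<psi> z) - \<psi> c" for z
  proof -
    have "c + \<psi> z = (\<phi> (\<psi> (f z)) + c) + \<psi> c + \<psi> (\<psi> z)" using A[of 0 z] by (simp add: add.assoc)
    then show ?thesis by (metis add_diff_cancel)
  qed
  have A': "\<phi> (\<psi> y) + c + \<psi> z = c + \<psi> z - \<psi> (\<psi> z) - \<psi> c + \<psi> (\<phi> y) + \<psi> c + \<psi> (\<psi> z)" for y z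
    using A[of y z] unfolding K[symmetric] by (simp add: add.assoc)
  show B: "\<phi> (\<psi> y) + c = c - \<psi> c + \<psi> (\<phi> y) + \<psi> c" for y
    using A'[of y 0] by simp
  show "t - \<psi> t \<in> center" unfolding center_def
  proof (intro CollectI allI)
    fix g
    obtain z where z: "t = \<psi> z" using \<open>bij \<psi>\<close> by (metis bij_pointE)
    \<comment> \<open>The variable \<open>y\<close> enters the identity only through \<open>\<phi> (\<psi> y)\<close>, conjugated by \<open>c\<close>.\<close>
    obtain y where y: "c + g - c = \<phi> (\<psi> y)" using \<open>bij \<phi>\<close> \<open>bij \<psi>\<close> by (metis bij_pointE)
    then have g: "c + g = \<phi> (\<psi> y) + c" by (metis diff_add_cancel)
    have "c + (g + t) = \<phi> (\<psi> y) + c + t" by (simp add: g flip: add.assoc)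
    also have "\<dots> = c + t - \<psi> t - \<psi> c + (\<psi> (\<phi> y) + \<psi> c) + \<psi> t"
      using A'[of y z] by (simp add: z add.assoc)
    also have "\<psi> (\<phi> y) + \<psi> c = \<psi> c + g"
    proof -
      have "c + g = c + (- \<psi> c + (\<psi> (\<phi> y) + \<psi> c))" using B[of y] unfolding g
        by (simp add: add.assoc diff_conv_add_uminus del: add_uminus_conv_diff)
      then have "g = - \<psi> c + (\<psi> (\<phi> y) + \<psi> c)" by simp
      then show ?thesis by (simp add: minus_add_cancel add.assoc[symmetric])
    qed
    also have "c + t - \<psi> t - \<psi> c + (\<psi> c + g) + \<psi> t = c + (t - \<psi> t + g + \<psi> t)"
      by (simp add: add.assoc[symmetric]) (simp add: algebra_simps)
    finally have "g + t = t - \<psi> t + g + \<psi> t" by simp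
    then show "g + (t - \<psi> t) = t - \<psi> t + g" by (metis add_diff_cancel add_diff_eq)
  qed
qed

text \<open>A bijective \<open>f\<close> makes every element of the form \<open>x - \<psi> x\<close>, hence central. If instead the quasigroup is
  simple, a single nonzero central element suffices, because the cosets of the center form
  a normal congruence.\<close>

lemma linear_F_commutative:
  assumes F: "F_quasi m" and m: "linear_over m \<phi> \<psi> c"
    and "bij (f_map m) \<or> (simple_quasigroup m \<and> \<not> (\<forall>x y. f_map m x = f_map m y))"
  shows "x + y = y + x"
proof -
  have \<phi>: "bij \<phi>" using m by (simp add: linear_over_def)
  have "center = UNIV"
  proof (cases "bij (f_map m)")
    case True
    have "g \<in> center" for g
    proof -
      obtain u where u: "g - c = \<phi> u" using \<phi> by (metis bij_pointE)
      obtain x where "u = f_map m x" using True by (metis bij_pointE)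
      then have "g - c = x - \<psi> x - c" using u linear_f_map[OF F m] by simp
      then have "g = x - \<psi> x" by (metis diff_add_cancel)
      then show ?thesis using linear_F_identities(2)[OF F m] by simp
    qed
    then show ?thesis by blast
  next
    case False
    then obtain x y where "f_map m x \<noteq> f_map m y" and s: "simple_quasigroup m" using assms(3) by blast
    then have "x - \<psi> x - c \<noteq> y - \<psi> y - c"
      using \<phi> linear_f_map[OF F m] by (metis bij_is_inj injD)
    then have "\<exists>z. z \<in> center \<and> z \<noteq> 0" using linear_F_identities(2)[OF F m] by metis
    moreover have "{(x, y). x - y \<in> center} = Id \<or> {(x, y). x - y \<in> center} = UNIV"
      using s center_congruence[OF m] unfolding simple_quasigroup_def by blast
    then have "center = {0} \<or> center = UNIV"
    proof
      assume *: "{(x, y). x - y \<in> center} = Id"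
      have "z = 0" if "z \<in> center" for z
      proof -
        have "(z, 0) \<in> {(x, y). x - y \<in> center}" using that by simp
        then show ?thesis unfolding * by simp
      qed
      then show ?thesis using \<open>\<exists>z. z \<in> center \<and> z \<noteq> 0\<close> by blast
    next
      assume *: "{(x, y). x - y \<in> center} = UNIV"
      have "z \<in> center" for z
      proof -
        have "(z, 0) \<in> {(x, y). x - y \<in> center}" unfolding * by simp
        then show ?thesis by simp
      qed
      then show ?thesis by blast
    qed
    ultimately show ?thesis by blast
  qed
  then show ?thesis unfolding center_def by blast
qed

end

context F_quasi
begin

text \<open>Fix \<open>b\<close> and consider the isotopic loop \<open>u + v = (R\<^sub>b\<inverse> u) \<cdot> (L\<^sub>b\<inverse> v)\<close>. Its left translations \<open>L\<^sub>x L\<^sub>b\<inverse>\<close>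
  commute with the left regular permutations, and as these act transitively they are all the right
  translations of the loop. Left and right translations commuting is associativity. Conjugation
  by \<open>R\<^sub>b\<close> and by \<open>L\<^sub>b\<close> permutes the right translations, so both maps are affine over the group.\<close>

lemma transitive_imp_linear:
  assumes T: "regular_orbits = UNIV"
  obtains add zro sub neg \<phi> \<psi> c where "class.group_add sub add zro neg"
    "group_add.linear_over add m \<phi> \<psi> c"
proof -
  fix b
  define \<alpha> where "\<alpha> x = x \<cdot> b" for x
  define \<beta> where "\<beta> x = b \<cdot> x" for x
  have \<alpha>: "bij \<alpha>" unfolding \<alpha>_def[abs_def] by (rule bij_right)
  have \<beta>: "bij \<beta>" unfolding \<beta>_def[abs_def] by (rule bij_left)
  have inv: "pinv \<alpha> (\<alpha> x) = x" "\<alpha> (pinv \<alpha> x) = x" "pinv \<beta> (\<beta> x) = x" "\<beta> (pinv \<beta> x) = x" for x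
    using \<alpha> \<beta> by (simp_all add: bij_is_inj bij_is_surj surj_f_inv_f)
  define add where "add u v = pinv \<alpha> u \<cdot> pinv \<beta> v" for u v
  define zro where "zro = b \<cdot> b"
  have m_plus: "x \<cdot> y = add (\<alpha> x) (\<beta> y)" for x y by (simp add: add_def inv)
  have zero: "zro = \<alpha> b" "zro = \<beta> b" by (simp_all add: zro_def \<alpha>_def \<beta>_def)
  have unit: "add zro v = v" "add u zro = u" for u v
  proof -
    show "add zro v = v" unfolding zero(1) add_def inv by (simp add: inv flip: \<beta>_def)
    show "add u zro = u" unfolding zero(2) add_def inv by (simp add: inv flip: \<alpha>_def)
  qed
  have reg_plus: "c (add u v) = add u (c v)" if c: "left_regular c" for c u v
  proof -
    obtain c' where c': "\<And>x u. c (x \<cdot> u) = x \<cdot> c' u" using c unfolding left_regular_def by blast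
    have "c v = c (b \<cdot> pinv \<beta> v)" by (simp add: inv flip: \<beta>_def)
    also have "\<dots> = \<beta> (c' (pinv \<beta> v))" by (simp only: c' \<beta>_def)
    finally have "pinv \<beta> (c v) = c' (pinv \<beta> v)" by (simp add: inv)
    then show ?thesis by (simp add: add_def c')
  qed
  have reg_ex: "\<exists>c. left_regular c \<and> (\<forall>v. c v = add v w)" for w
  proof -
    have "(zro, w) \<in> regular_orbits" using T by simp
    then obtain c where c: "left_regular c" "c zro = w" by (rule regular_orbitsE)
    then have "c v = add v w" for v using reg_plus[OF c(1), of v zro] by (simp add: unit)
    then show ?thesis using c(1) by blast
  qed
  have assoc: "add (add u v) w = add u (add v w)" for u v w
  proof -
    obtain c where "left_regular c" "\<And>v. c v = add v w" using reg_ex[of w] by blast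
    then show ?thesis using reg_plus[of c u v] by simp
  qed
  have "Group.group (on_UNIV add zro)"
  proof (rule groupI)
    fix x
    obtain z where "\<beta> b = z \<cdot> pinv \<beta> x" by (rule right_div)
    then have "add (\<alpha> z) x = zro" by (simp add: add_def inv zero(2))
    then show "\<exists>y\<in>carrier (on_UNIV add zro). y \<otimes>\<^bsub>on_UNIV add zro\<^esub> x = \<one>\<^bsub>on_UNIV add zro\<^esub>" by auto
  qed (simp_all add: assoc unit)
  then obtain sub neg where G: "class.group_add sub add zro neg" by (rule group_add_of_group)
  interpret G: group_add sub add zro neg by (rule G)
  \<comment> \<open>A permutation \<open>\<gamma>\<close> that normalizes the right translations of a group is affine.\<close>
  have affine: "\<gamma> (add v w) = add (\<gamma> v) (add (neg (\<gamma> zro)) (\<gamma> w))"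
    if norm: "\<And>c. left_regular c \<Longrightarrow> \<exists>k. left_regular k \<and> (\<forall>y. k (\<gamma> y) = \<gamma> (c y))" for \<gamma> v w
  proof -
    obtain c where c: "left_regular c" "\<And>v. c v = add v w" using reg_ex[of w] by blast
    obtain k where k: "left_regular k" "\<And>y. k (\<gamma> y) = \<gamma> (c y)" using norm[OF c(1)] by blast
    have kv: "k v = add v (k zro)" for v using reg_plus[OF k(1), of v zro] by (simp add: unit)
    have 1: "\<gamma> (add v w) = add (\<gamma> v) (k zro)" for v
      using k(2)[of v] kv[of "\<gamma> v"] by (simp add: c(2))
    show ?thesis unfolding 1 using 1[of zro] by (simp add: unit G.add.assoc[symmetric])
  qed
  have aff_\<alpha>: "\<alpha> (add v w) = add (\<alpha> v) (add (neg (\<alpha> zro)) (\<alpha> w))" for v w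
  proof (rule affine)
    fix c assume "left_regular c"
    then show "\<exists>k. left_regular k \<and> (\<forall>y. k (\<alpha> y) = \<alpha> (c y))"
      unfolding \<alpha>_def by (rule left_regular_mult_right) blast
  qed
  have aff_\<beta>: "\<beta> (add v w) = add (\<beta> v) (add (neg (\<beta> zro)) (\<beta> w))" for v w
  proof (rule affine)
    fix c assume "left_regular c"
    then show "\<exists>k. left_regular k \<and> (\<forall>y. k (\<beta> y) = \<beta> (c y))"
      unfolding \<beta>_def by (rule left_regular_mult_left) blast
  qed
  define \<phi> where "\<phi> x = sub (\<alpha> x) (\<alpha> zro)" for x
  define \<psi> where "\<psi> x = add (neg (\<beta> zro)) (\<beta> x)" for x
  define c where "c = add (\<alpha> zro) (\<beta> zro)"
  have "bij (\<lambda>x. sub x a)" for a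
    by (rule bij_betw_byWitness[of _ "\<lambda>x. add x a"]) auto
  then have bij\<phi>: "bij \<phi>" unfolding \<phi>_def[abs_def] using \<alpha> bij_comp[of \<alpha> "\<lambda>x. sub x (\<alpha> zro)"] by (simp add: comp_def)
  have "bij (\<lambda>x. add a x)" for a
    by (rule bij_betw_byWitness[of _ "\<lambda>x. add (neg a) x"]) (auto simp: G.add.assoc[symmetric])
  then have bij\<psi>: "bij \<psi>" unfolding \<psi>_def[abs_def] using \<beta> bij_comp[of \<beta> "\<lambda>x. add (neg (\<beta> zro)) x"] by (simp add: comp_def)
  have "G.linear_over m \<phi> \<psi> c"
    unfolding G.linear_over_def G.additive_map_def
  proof (intro conjI allI bij\<phi> bij\<psi>)
    show "\<phi> (add x y) = add (\<phi> x) (\<phi> y)" for x y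
      unfolding \<phi>_def aff_\<alpha> by (simp only: G.diff_conv_add_uminus G.add.assoc)
    show "\<psi> (add x y) = add (\<psi> x) (\<psi> y)" for x y
      unfolding \<psi>_def aff_\<beta> by (simp add: G.add.assoc)
    show "x \<cdot> y = add (add (\<phi> x) c) (\<psi> y)" for x y
      unfolding m_plus \<phi>_def \<psi>_def c_def by (simp add: G.add.assoc[symmetric])
  qed
  then show thesis using G that by blast
qed

end

section \<open>F-quasigroups over abelian groups and the four classes\<close>

lemma ab_group_add_of_group_add:
  assumes "class.group_add sub add zro neg" "\<And>x y. add x y = add y x"
  shows "class.ab_group_add add zro sub neg"
proof -
  interpret G: group_add sub add zro neg by fact
  show ?thesis
    by unfold_locales (rule assms(2) | simp)+
qed

lemma ab_group_add_of_comm_group: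
  assumes "comm_group (on_UNIV add zro)"
  obtains sub neg where "class.ab_group_add add zro sub neg"
proof -
  interpret comm_group "on_UNIV add zro" by fact
  obtain sub neg where G: "class.group_add sub add zro neg"
    using group_add_of_group[OF group_axioms] .
  have comm: "add x y = add y x" for x y using m_comm[of x y] by simp
  show thesis by (rule that[OF ab_group_add_of_group_add[OF G comm]])
qed

context ab_group_add
begin

lemma comm_group_on_UNIV: "comm_group (on_UNIV (+) 0)"
  by (rule group.group_comm_groupI[OF group_on_UNIV]) (simp add: add.commute)

lemma linear_over_add: "linear_over (+) id id 0"
  by (simp add: linear_over_def additive_map_def)

lemma coset_congruence_abelian:
  assumes "linear_over m \<phi> \<psi> c" "additive_subgroup H"
    "\<And>h. \<phi> h \<in> H \<longleftrightarrow> h \<in> H" "\<And>h. \<psi> h \<in> H \<longleftrightarrow> h \<in> H"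
  shows "normal_congruence m {(x, y). x - y \<in> H}"
  by (rule coset_congruence[OF assms(1,2) _ assms(3,4)]) simp

text \<open>Varying the second argument of \<open>\<phi> x + c + \<psi> z\<close> shows that a normal congruence is invariant under
  all shifts, so it is the relation of belonging to the same coset of its class of \<open>0\<close>.\<close>

lemma linear_congruence:
  assumes m: "linear_over m \<phi> \<psi> c" and \<theta>: "normal_congruence m \<theta>"
  obtains H where "additive_subgroup H" "\<theta> = {(x, y). x - y \<in> H}"
    "\<And>h. \<phi> h \<in> H \<longleftrightarrow> h \<in> H" "\<And>h. \<psi> h \<in> H \<longleftrightarrow> h \<in> H"
proof -
  have mx: "m x y = \<phi> x + c + \<psi> y" and add: "additive_map \<phi>" "additive_map \<psi>" and "bij \<phi>" "bij \<psi>" for x y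
    using m by (simp_all add: linear_over_def)
  have eq: "equiv UNIV \<theta>" and ml: "(m z x, m z y) \<in> \<theta> \<longleftrightarrow> (x, y) \<in> \<theta>"
    and mr: "(m x z, m y z) \<in> \<theta> \<longleftrightarrow> (x, y) \<in> \<theta>" for x y z
    using \<theta> unfolding normal_congruence_iff by blast+
  have tr: "(x, y) \<in> \<theta> \<Longrightarrow> (y, z) \<in> \<theta> \<Longrightarrow> (x, z) \<in> \<theta>" and sy: "(x, y) \<in> \<theta> \<Longrightarrow> (y, x) \<in> \<theta>"
    and rf: "(x, x) \<in> \<theta>" for x y z
    using equivE[OF eq] by (meson transD, meson symD, meson UNIV_I refl_onD)
  have \<phi>w: "(\<phi> x + w, \<phi> y + w) \<in> \<theta> \<longleftrightarrow> (x, y) \<in> \<theta>" for x y w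
  proof -
    obtain z where z: "w - c = \<psi> z" using \<open>bij \<psi>\<close> by (metis bij_pointE)
    have "m x z = \<phi> x + w" for x by (simp add: mx algebra_simps flip: z)
    then show ?thesis using mr[of x z y] by simp
  qed
  have \<phi>: "(\<phi> x, \<phi> y) \<in> \<theta> \<longleftrightarrow> (x, y) \<in> \<theta>" for x y using \<phi>w[of x 0 y] by simp
  have shift: "(x + w, y + w) \<in> \<theta> \<longleftrightarrow> (x, y) \<in> \<theta>" for x y w
  proof -
    obtain x' y' where "x = \<phi> x'" "y = \<phi> y'" using \<open>bij \<phi>\<close> by (metis bij_pointE)
    then show ?thesis by (simp add: \<phi>w \<phi>)
  qed
  have \<psi>: "(\<psi> x, \<psi> y) \<in> \<theta> \<longleftrightarrow> (x, y) \<in> \<theta>" for x y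
    using ml[of 0 x y] shift[of "\<psi> x" c "\<psi> y"] by (simp add: mx additive_map_0[OF add(1)] add.commute)
  have diff: "(x, y) \<in> \<theta> \<longleftrightarrow> (x - y, 0) \<in> \<theta>" for x y
    using shift[of x "- y" y] by simp
  define H where "H = {h. (h, 0) \<in> \<theta>}"
  show thesis
  proof (rule that[of H])
    show "additive_subgroup H"
      unfolding additive_subgroup_def H_def
    proof (intro conjI ballI)
      fix x y assume "x \<in> {h. (h, 0) \<in> \<theta>}" "y \<in> {h. (h, 0) \<in> \<theta>}"
      then have "(x, y) \<in> \<theta>" using tr sy by blast
      then show "x - y \<in> {h. (h, 0) \<in> \<theta>}" using diff by blast
    qed (simp add: rf)
    show "\<theta> = {(x, y). x - y \<in> H}" using diff by (auto simp: H_def)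
    show "\<phi> h \<in> H \<longleftrightarrow> h \<in> H" for h using \<phi>[of h 0] by (simp add: H_def additive_map_0[OF add(1)])
    show "\<psi> h \<in> H \<longleftrightarrow> h \<in> H" for h using \<psi>[of h 0] by (simp add: H_def additive_map_0[OF add(2)])
  qed
qed

lemma coset_relation_trivial:
  assumes "{(x, y). x - y \<in> H} = Id \<or> {(x, y). x - y \<in> H} = UNIV" "additive_subgroup H"
  shows "H = {0} \<or> H = UNIV"
proof -
  have iff: "h \<in> H \<longleftrightarrow> (h, 0) \<in> {(x, y). x - y \<in> H}" for h by simp
  from assms(1) show ?thesis
  proof
    assume R: "{(x, y). x - y \<in> H} = Id"
    have "h \<in> H \<longleftrightarrow> h = 0" for h using iff[of h] unfolding R by simp
    then show ?thesis by blast
  next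
    assume R: "{(x, y). x - y \<in> H} = UNIV"
    have "h \<in> H" for h using iff[of h] unfolding R by simp
    then show ?thesis by blast
  qed
qed

lemma subgroup_relation_trivial:
  assumes "H = {0} \<or> H = UNIV"
  shows "{(x, y). x - y \<in> H} = Id \<or> {(x, y). x - y \<in> H} = UNIV"
  using assms by (elim disjE) (simp_all add: set_eq_iff)

text \<open>The normal congruences of \<open>x + \<psi> y\<close> and the \<open>\<psi>\<close>-admissible normal congruences of \<open>+\<close> are both given
  by the cosets of the subgroups \<open>H\<close> with \<open>\<psi> h \<in> H \<longleftrightarrow> h \<in> H\<close>.\<close>

lemma sum_right_simple_iff:
  assumes m: "\<And>x y. m x y = x + \<psi> y" and \<psi>: "additive_map \<psi>" "bij \<psi>"
    and q: "quasigroup m" "quasigroup (+)"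
  shows "simple_quasigroup m \<longleftrightarrow> alpha_simple \<psi> (+)"
proof -
  have L: "linear_over m id \<psi> 0" using \<psi> by (simp add: linear_over_def additive_map_def m)
  have inv: "inv_into UNIV \<psi> (\<psi> x) = x" "\<psi> (inv_into UNIV \<psi> x) = x" for x
    using \<psi>(2) by (simp_all add: bij_is_inj bij_is_surj surj_f_inv_f)
  have "normal_congruence m \<theta> \<longleftrightarrow> normal_congruence (+) \<theta> \<and> admissible \<psi> \<theta>" for \<theta>
  proof
    assume "normal_congruence m \<theta>"
    then obtain H where H: "additive_subgroup H" "\<theta> = {(x, y). x - y \<in> H}" "\<And>h. \<psi> h \<in> H \<longleftrightarrow> h \<in> H"
      using linear_congruence[OF L] by metis
    have "normal_congruence (+) \<theta>"
      unfolding H(2) by (rule coset_congruence_abelian[OF linear_over_add H(1)]) simp_all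
    moreover have "(\<psi> x, \<psi> y) \<in> \<theta> \<longleftrightarrow> (x, y) \<in> \<theta>" for x y
      using H(3)[of "x - y"] by (simp add: H(2) additive_map_diff[OF \<psi>(1)])
    ultimately show "normal_congruence (+) \<theta> \<and> admissible \<psi> \<theta>"
      unfolding admissible_def by (metis inv(2))
  next
    assume *: "normal_congruence (+) \<theta> \<and> admissible \<psi> \<theta>"
    then obtain H where H: "additive_subgroup H" "\<theta> = {(x, y). x - y \<in> H}"
      using linear_congruence[OF linear_over_add] by metis
    have "(\<psi> h, \<psi> 0) \<in> \<theta> \<longleftrightarrow> (h, 0) \<in> \<theta>" for h
      using * inv(1) unfolding admissible_def by metis
    then have "\<psi> h \<in> H \<longleftrightarrow> h \<in> H" for h
      by (simp add: H(2) additive_map_0[OF \<psi>(1)])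
    then show "normal_congruence m \<theta>"
      unfolding H(2) by (intro coset_congruence_abelian[OF L H(1)]) simp_all
  qed
  then show ?thesis using q \<psi>(2) by (simp add: simple_quasigroup_def alpha_simple_def)
qed

lemma linear_e_map:
  assumes "F_quasi m" "linear_over m \<phi> \<psi> c"
  shows "\<psi> (e_map m x) = x - \<phi> x - c"
proof -
  interpret F_quasi m by fact
  have "m x y = \<phi> x + c + \<psi> y" for x y using assms(2) by (simp add: linear_over_def)
  then have "\<phi> x + c + \<psi> (e x) = x" using e_right[of x] by metis
  then have "\<psi> (e x) = x - (\<phi> x + c)" by (metis add_diff_cancel_left')
  then show ?thesis by (simp add: algebra_simps)
qed

lemma linear_commute:
  assumes "F_quasi m" "linear_over m \<phi> \<psi> c"
  shows "\<phi> (\<psi> y) = \<psi> (\<phi> y)"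
  using linear_F_identities(1)[OF assms, of y] by (simp add: algebra_simps)

text \<open>Surjectivity is the point that injectivity does not settle on an infinite set. The range of
  \<open>1 - \<beta>\<close> is a subgroup on which \<open>\<phi>\<close>, \<open>\<psi>\<close> and their inverses act, so it is trivial or everything, and up
  to the bijection \<open>\<alpha>\<close> and a shift it is the range of \<open>h\<close>.\<close>

lemma linear_endomorphism_cases:
  assumes F: "F_quasi m" and m: "linear_over m \<phi> \<psi> c" and s: "simple_quasigroup m"
    and \<alpha>: "bij \<alpha>" and \<beta>: "additive_map \<beta>" "\<And>x. \<beta> (\<phi> x) = \<phi> (\<beta> x)" "\<And>x. \<beta> (\<psi> x) = \<psi> (\<beta> x)"
    and h: "endomorphism m h" "\<And>x. \<alpha> (h x) = x - \<beta> x - c"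
  shows "bij h \<or> zero_endomorphism m h"
proof -
  interpret F_quasi m by fact
  have \<phi>: "additive_map \<phi>" "bij \<phi>" and \<psi>: "additive_map \<psi>" "bij \<psi>"
    using m by (simp_all add: linear_over_def)
  let ?H = "range (\<lambda>x. x - \<beta> x)"
  have sub: "additive_subgroup ?H"
    unfolding additive_subgroup_def
  proof (intro conjI ballI)
    show "0 \<in> ?H" by (rule image_eqI[of _ _ 0]) (simp_all add: additive_map_0[OF \<beta>(1)])
    fix u v assume "u \<in> ?H" "v \<in> ?H"
    then obtain x y where "u = x - \<beta> x" "v = y - \<beta> y" by blast
    then have "u - v = (x - \<beta> x) - (y - \<beta> y)" by simp
    also have "\<dots> = (x - y) - \<beta> (x - y)" by (simp add: additive_map_diff[OF \<beta>(1)] algebra_simps)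
    finally have "u - v = (x - y) - \<beta> (x - y)" .
    then show "u - v \<in> ?H" by blast
  qed
  have inv: "\<gamma> v \<in> ?H \<longleftrightarrow> v \<in> ?H" if \<gamma>: "additive_map \<gamma>" "bij \<gamma>" "\<And>x. \<beta> (\<gamma> x) = \<gamma> (\<beta> x)" for \<gamma> v
  proof
    assume "v \<in> ?H"
    then obtain x where "v = x - \<beta> x" by blast
    then have "\<gamma> v = \<gamma> x - \<beta> (\<gamma> x)" by (simp add: additive_map_diff[OF \<gamma>(1)] \<gamma>(3))
    then show "\<gamma> v \<in> ?H" by blast
  next
    assume "\<gamma> v \<in> ?H"
    then obtain y where y: "\<gamma> v = y - \<beta> y" by blast
    obtain x where "y = \<gamma> x" using \<gamma>(2) by (metis bij_pointE)
    then have "\<gamma> v = \<gamma> (x - \<beta> x)" using y by (simp add: additive_map_diff[OF \<gamma>(1)] \<gamma>(3))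
    then have "v = x - \<beta> x" using \<gamma>(2) by (metis bij_is_inj injD)
    then show "v \<in> ?H" by blast
  qed
  have "normal_congruence m {(x, y). x - y \<in> ?H}"
    by (rule coset_congruence_abelian[OF m sub]) (rule inv[OF \<phi> \<beta>(2)], rule inv[OF \<psi> \<beta>(3)])
  then have "?H = {0} \<or> ?H = UNIV"
    using s coset_relation_trivial[OF _ sub] unfolding simple_quasigroup_def by blast
  then show ?thesis
  proof
    assume "?H = {0}"
    then have "\<alpha> (h x) = 0 - c" for x unfolding h(2) by (metis rangeI singletonD)
    then have "h x = h y" for x y using \<alpha> by (metis bij_is_inj injD)
    then show ?thesis using h(1) unfolding zero_endomorphism_def by blast
  next
    assume U: "?H = UNIV"
    have "surj h" unfolding surj_def
    proof
      fix y
      have "\<alpha> y + c \<in> ?H" using U by simp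
      then obtain x where "\<alpha> y + c = x - \<beta> x" by blast
      then have "\<alpha> (h x) = \<alpha> y" by (simp add: h(2) flip: \<open>\<alpha> y + c = x - \<beta> x\<close>)
      then show "\<exists>x. y = h x" using \<alpha> by (metis bij_is_inj injD)
    qed
    then show ?thesis using simple_endo_cases[OF s h(1)] by (auto simp: bij_def)
  qed
qed

lemma linear_e_f_cases:
  assumes F: "F_quasi m" and m: "linear_over m \<phi> \<psi> c" and s: "simple_quasigroup m"
  shows "bij (e_map m) \<or> zero_endomorphism m (e_map m)" "bij (f_map m) \<or> zero_endomorphism m (f_map m)"
proof -
  interpret F_quasi m by fact
  have \<phi>: "additive_map \<phi>" "bij \<phi>" and \<psi>: "additive_map \<psi>" "bij \<psi>"
    using m by (simp_all add: linear_over_def)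
  show "bij e \<or> zero_endomorphism m e"
    by (rule linear_endomorphism_cases[OF F m s \<psi>(2) \<phi>(1) refl linear_commute[OF F m] endomorphism_e linear_e_map[OF F m]])
  show "bij f \<or> zero_endomorphism m f"
    by (rule linear_endomorphism_cases[OF F m s \<phi>(2) \<psi>(1) linear_commute[OF F m, symmetric] refl endomorphism_f linear_f_map[OF F m]])
qed

text \<open>The operation becomes \<open>\<phi> x + (1 - \<phi>) y\<close>, with constant and \<open>\<psi>\<close> cancelled.\<close>

lemma linear_right_distributive:
  assumes F: "F_quasi m" and m: "linear_over m \<phi> \<psi> c"
  defines "d \<equiv> \<lambda>x y. m x (e_map m y)"
  shows "d (d x u) v = d (d x v) (d u v)"
proof -
  have d: "d x y = \<phi> x + (y - \<phi> y)" for x y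
  proof -
    have "d x y = \<phi> x + c + \<psi> (e_map m y)" using m by (simp add: d_def linear_over_def)
    then show ?thesis unfolding linear_e_map[OF F m] by (simp add: algebra_simps)
  qed
  have \<phi>: "additive_map \<phi>" using m by (simp add: linear_over_def)
  show ?thesis unfolding d by (simp add: additive_mapD[OF \<phi>] additive_map_diff[OF \<phi>] algebra_simps)
qed

text \<open>The \<open>e\<close>-invariant congruences belong to the subgroups that are invariant in both directions under
  \<open>\<phi>\<close>, \<open>\<psi>\<close> and \<open>\<tau> = 1 - \<phi>\<close>, because \<open>\<psi> (e x - e y) = \<tau> (x - y)\<close>. An arbitrary normal congruence is only
  known to be invariant under \<open>\<phi>\<close> and \<open>\<psi>\<close>, hence under \<open>\<tau>\<close> but not under \<open>\<tau>\<inverse>\<close>; this gap is closed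
  by \<open>simple_without_inverse\<close>.\<close>

lemma linear_e_simple_imp_simple:
  assumes F: "F_quasi m" and m: "linear_over m \<phi> \<psi> c" and e: "bij (e_map m)"
    and S: "\<And>\<theta>. normal_congruence m \<theta> \<Longrightarrow> (\<And>x y. (e_map m x, e_map m y) \<in> \<theta> \<longleftrightarrow> (x, y) \<in> \<theta>) \<Longrightarrow> \<theta> = Id \<or> \<theta> = UNIV"
    and \<theta>: "normal_congruence m \<theta>"
  shows "\<theta> = Id \<or> \<theta> = UNIV"
proof -
  have \<phi>: "additive_map \<phi>" "bij \<phi>" and \<psi>: "additive_map \<psi>" "bij \<psi>"
    using m by (simp_all add: linear_over_def)
  note ex = linear_e_map[OF F m]
  define \<tau> where "\<tau> v = v - \<phi> v" for v
  have \<tau>: "additive_map \<tau>"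
    unfolding additive_map_def \<tau>_def by (simp add: additive_mapD[OF \<phi>(1)] algebra_simps)
  have \<tau>\<phi>: "v - \<tau> v = \<phi> v" for v by (simp add: \<tau>_def algebra_simps)
  have "bij (\<lambda>x. x + c)" by (rule bij_betw_byWitness[of _ "\<lambda>x. x - c"]) auto
  then have "bij ((\<lambda>x. x + c) \<circ> (\<psi> \<circ> e_map m))" using \<psi>(2) e by (intro bij_comp)
  moreover have "(\<lambda>x. x + c) \<circ> (\<psi> \<circ> e_map m) = \<tau>" by (auto simp: ex \<tau>_def)
  ultimately have bij\<tau>: "bij \<tau>" by simp
  obtain H where H: "additive_subgroup H" "\<theta> = {(x, y). x - y \<in> H}"
    "\<And>h. \<phi> h \<in> H \<longleftrightarrow> h \<in> H" "\<And>h. \<psi> h \<in> H \<longleftrightarrow> h \<in> H"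
    using linear_congruence[OF m \<theta>] by metis
  have "H = {0} \<or> H = UNIV"
  proof (rule simple_without_inverse[OF \<tau> bij\<tau> _ \<psi> _ _ H(1) _ H(4)])
    show "bij (\<lambda>v. v - \<tau> v)" using \<phi>(2) by (simp add: \<tau>\<phi>)
    show "\<tau> (\<psi> v) = \<psi> (\<tau> v)" for v
      by (simp add: \<tau>_def additive_map_diff[OF \<psi>(1)] linear_commute[OF F m])
    show "v - \<tau> v \<in> H \<longleftrightarrow> v \<in> H" for v by (simp add: \<tau>\<phi> H(3))
  next
    fix N assume N: "additive_subgroup N" "\<And>v. \<tau> v \<in> N \<longleftrightarrow> v \<in> N" "\<And>v. v - \<tau> v \<in> N \<longleftrightarrow> v \<in> N"
      "\<And>v. \<psi> v \<in> N \<longleftrightarrow> v \<in> N"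
    have "{(x, y). x - y \<in> N} = Id \<or> {(x, y). x - y \<in> N} = UNIV"
    proof (rule S)
      show "normal_congruence m {(x, y). x - y \<in> N}"
        by (rule coset_congruence_abelian[OF m N(1) _ N(4)]) (use N(3) in \<open>simp add: \<tau>\<phi>\<close>)
      show "(e_map m x, e_map m y) \<in> {(x, y). x - y \<in> N} \<longleftrightarrow> (x, y) \<in> {(x, y). x - y \<in> N}" for x y
      proof -
        have "\<psi> (e_map m x - e_map m y) = \<tau> (x - y)"
          unfolding additive_map_diff[OF \<psi>(1)] additive_map_diff[OF \<tau>] ex
          by (simp add: \<tau>_def algebra_simps)
        then have "\<psi> (e_map m x - e_map m y) \<in> N \<longleftrightarrow> \<tau> (x - y) \<in> N" by simp
        then show ?thesis by (simp add: N(2,4))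
      qed
    qed
    then show "N = {0} \<or> N = UNIV" using coset_relation_trivial N(1) by blast
  qed
  then show ?thesis unfolding H(2) by (rule subgroup_relation_trivial)
qed

end

lemma normal_congruence_dual: "normal_congruence (\<lambda>x y. m y x) \<theta> \<longleftrightarrow> normal_congruence m \<theta>"
  by (simp only: normal_congruence_iff conj_ac)

lemma simple_quasigroup_dual: "simple_quasigroup (\<lambda>x y. m y x) \<longleftrightarrow> simple_quasigroup m"
proof -
  have "quasigroup (\<lambda>x y. m y x) \<longleftrightarrow> quasigroup m" unfolding quasigroup_def by (rule conj_commute)
  then show ?thesis by (simp only: simple_quasigroup_def normal_congruence_dual[of m])
qed

lemma zero_endomorphism_dual: "zero_endomorphism (\<lambda>x y. m y x) h \<longleftrightarrow> zero_endomorphism m h"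
proof -
  have "endomorphism (\<lambda>x y. m y x) h \<longleftrightarrow> endomorphism m h"
    unfolding endomorphism_def by (rule all_comm)
  then show ?thesis by (simp only: zero_endomorphism_def)
qed

lemma sum_left_form_iff_dual:
  "sum_left_form m add zro \<phi> \<longleftrightarrow> sum_right_form (\<lambda>x y. m y x) add zro \<phi>"
proof (cases "comm_group (on_UNIV add zro)")
  case True
  interpret comm_group "on_UNIV add zro" by fact
  have comm: "add x y = add y x" for x y using m_comm[of x y] by simp
  have "(\<forall>x y. m x y = add (\<phi> x) y) \<longleftrightarrow> (\<forall>x y. m y x = add x (\<phi> y))"
    unfolding comm[of "\<phi> _"] by blast
  then show ?thesis by (simp add: sum_left_form_def sum_right_form_def)
qed (simp add: sum_left_form_def sum_right_form_def)

lemma sum_right_form_simple: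
  assumes "quasigroup m" "sum_right_form m add zro \<psi>"
  shows "simple_quasigroup m"
proof -
  have a: "comm_group (on_UNIV add zro)" "alpha_simple \<psi> add" "automorphism add \<psi>" "\<And>x y. m x y = add x (\<psi> y)"
    using assms(2) by (auto simp: sum_right_form_def)
  obtain sub neg where "class.ab_group_add add zro sub neg" using ab_group_add_of_comm_group[OF a(1)] .
  then interpret ab_group_add add zro sub neg .
  have "simple_quasigroup m \<longleftrightarrow> alpha_simple \<psi> add"
    using a(3) assms(1) group_imp_quasigroup[OF group_on_UNIV]
    by (intro sum_right_simple_iff a(4)) (auto simp: automorphism_def endomorphism_def additive_map_def)
  then show ?thesis using a(2) by simp
qed

context F_quasi
begin

text \<open>For \<open>e = u\<close> the left law reads \<open>x(yz) = (xy) \<cdot> \<psi> z\<close> with \<open>\<psi> = L\<^sub>u\<close>. At \<open>x = u\<close> it says that \<open>\<psi>\<close> is an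
  automorphism, and written in terms of \<open>x + y = x \<cdot> \<psi>\<inverse> y\<close> it is the associative law.\<close>

lemma e_const_imp_group:
  assumes e: "\<And>x. e x = u"
  obtains add \<psi> where "Group.group (on_UNIV add u)" "automorphism add \<psi>" "\<And>x y. x \<cdot> y = add x (\<psi> y)"
proof -
  define \<psi> where "\<psi> y = u \<cdot> y" for y
  have bij: "bij \<psi>" unfolding \<psi>_def[abs_def] by (rule bij_left)
  have inv: "pinv \<psi> (\<psi> x) = x" "\<psi> (pinv \<psi> x) = x" for x
    using bij by (simp_all add: bij_is_inj bij_is_surj surj_f_inv_f)
  have ru: "x \<cdot> u = x" for x using e_right[of x] by (simp only: e)
  have lF: "x \<cdot> (y \<cdot> z) = (x \<cdot> y) \<cdot> \<psi> z" for x y z using left_F[of x y z] by (simp only: e \<psi>_def)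
  have hom: "\<psi> (y \<cdot> z) = \<psi> y \<cdot> \<psi> z" for y z using lF[of u y z] by (simp only: \<psi>_def)
  have \<psi>u: "\<psi> u = u" unfolding \<psi>_def by (rule ru)
  define add where "add x y = x \<cdot> pinv \<psi> y" for x y
  have mx: "x \<cdot> y = add x (\<psi> y)" for x y by (simp add: add_def inv)
  have assoc: "add (add x y) z = add x (add y z)" for x y z
  proof -
    define y' z' where "y' = pinv \<psi> y" and "z' = pinv \<psi> (pinv \<psi> z)"
    have y: "y = \<psi> y'" and z: "z = \<psi> (\<psi> z')" by (simp_all add: y'_def z'_def inv)
    have "add (add x y) z = (x \<cdot> y') \<cdot> \<psi> z'" by (simp add: add_def y z inv)
    also have "\<dots> = x \<cdot> (y' \<cdot> z')" by (simp only: lF)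
    also have "\<dots> = add x (add y z)" by (simp add: add_def y z inv flip: hom)
    finally show ?thesis .
  qed
  have "Group.group (on_UNIV add u)"
  proof (rule groupI)
    fix x
    obtain z where "u = z \<cdot> pinv \<psi> x" by (rule right_div)
    then show "\<exists>y\<in>carrier (on_UNIV add u). y \<otimes>\<^bsub>on_UNIV add u\<^esub> x = \<one>\<^bsub>on_UNIV add u\<^esub>"
      by (auto simp: add_def)
    show "\<one>\<^bsub>on_UNIV add u\<^esub> \<otimes>\<^bsub>on_UNIV add u\<^esub> x = x"
      by (simp add: add_def inv flip: \<psi>_def)
  qed (simp_all add: assoc)
  moreover have "automorphism add \<psi>"
    using bij by (simp add: automorphism_def endomorphism_def add_def hom inv)
  ultimately show thesis using mx that by blast
qed

lemma simple_sum_right: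
  assumes s: "simple_quasigroup m" and e: "zero_endomorphism m e" and f: "\<not> zero_endomorphism m f"
  shows "bij f \<and> (\<exists>add zro \<psi>. sum_right_form m add zro \<psi>)"
proof -
  obtain u where u: "\<And>x. e x = u" using e unfolding zero_endomorphism_def by blast
  obtain add \<psi> where G: "Group.group (on_UNIV add u)" and \<psi>: "automorphism add \<psi>" and mx: "\<And>x y. x \<cdot> y = add x (\<psi> y)"
    using e_const_imp_group[OF u] by metis
  obtain sub neg where GA: "class.group_add sub add u neg" using group_add_of_group[OF G] .
  then interpret G: group_add sub add u neg .
  have L: "G.linear_over m id \<psi> u"
    using \<psi> by (simp add: G.linear_over_def G.additive_map_def automorphism_def endomorphism_def mx)
  have "\<not> (\<forall>x y. f x = f y)" using f endomorphism_f unfolding zero_endomorphism_def by metis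
  then have comm: "add x y = add y x" for x y
    using G.linear_F_commutative[OF F_quasi_axioms L] s by blast
  interpret ab_group_add add u sub neg
    by (rule ab_group_add_of_group_add[OF GA comm])
  have "G.additive_map \<psi>" "bij \<psi>"
    using \<psi> by (auto simp: automorphism_def endomorphism_def G.additive_map_def)
  then have "alpha_simple \<psi> add"
    using sum_right_simple_iff[of m \<psi>, OF mx _ _ quasigroup group_imp_quasigroup[OF G]] s by blast
  then have "sum_right_form m add u \<psi>"
    using comm_group_on_UNIV \<psi> mx by (simp add: sum_right_form_def)
  moreover have "bij f" using linear_e_f_cases(2)[OF F_quasi_axioms L s] f by blast
  ultimately show ?thesis by blast
qed

lemma zero_e_f_imp_group:
  assumes e: "zero_endomorphism m e" and f: "zero_endomorphism m f"
  shows "\<exists>u. Group.group (on_UNIV m u)"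
proof -
  obtain u v where u: "\<And>x. e x = u" and v: "\<And>x. f x = v"
    using e f unfolding zero_endomorphism_def by metis
  have ru: "x \<cdot> u = x" for x using e_right[of x] by (simp only: u)
  have lv: "v \<cdot> x = x" for x using f_left[of x] by (simp only: v)
  have "u = v" using ru[of v] lv[of u] by simp
  have assoc: "(x \<cdot> y) \<cdot> z = x \<cdot> (y \<cdot> z)" for x y z
    using left_F[of x y z] lv \<open>u = v\<close> by (simp add: u)
  have "Group.group (on_UNIV m u)"
  proof (rule groupI)
    fix x
    obtain z where "u = z \<cdot> x" by (rule right_div)
    then show "\<exists>y\<in>carrier (on_UNIV m u). y \<otimes>\<^bsub>on_UNIV m u\<^esub> x = \<one>\<^bsub>on_UNIV m u\<^esub>" by auto
  qed (simp_all add: assoc lv \<open>u = v\<close>)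
  then show ?thesis ..
qed

text \<open>Left distributivity of \<open>x \<cdot> e y\<close> is the left law combined with \<open>e\<close> being an endomorphism; right
  distributivity has no such direct reason and is left as a hypothesis.\<close>

lemma distributive_formI:
  assumes s: "simple_quasigroup m" and e: "bij e"
    and right: "\<And>x u v. (x \<cdot> e u) \<cdot> e v = (x \<cdot> e v) \<cdot> e (u \<cdot> e v)"
  shows "distributive_form m (\<lambda>x y. x \<cdot> e y) (pinv e)"
proof -
  have inv: "pinv e (e x) = x" "e (pinv e x) = x" for x
    using e by (simp_all add: bij_is_inj bij_is_surj surj_f_inv_f)
  have "automorphism m e" using e endomorphism_e by (simp add: automorphism_def)
  then have a: "automorphism m (pinv e)" by (rule automorphism_inv)
  have q: "quasigroup (\<lambda>x y. x \<cdot> e y)"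
    unfolding quasigroup_def
  proof (intro conjI allI)
    show "\<exists>!x. a \<cdot> e x = b" for a b
    proof -
      obtain y where "b = a \<cdot> y" by (rule left_div)
      then show ?thesis by (intro ex1I[of _ "pinv e y"]) (auto simp: inv)
    qed
    show "\<exists>!y. y \<cdot> e a = b" for a b
      using quasigroup unfolding quasigroup_def by blast
  qed
  have "distributive_quasigroup (\<lambda>x y. x \<cdot> e y)"
    unfolding distributive_quasigroup_def
  proof (intro conjI allI q right)
    show "x \<cdot> e (u \<cdot> e v) = (x \<cdot> e u) \<cdot> e (x \<cdot> e v)" for x u v
      unfolding e_hom by (rule left_F)
  qed
  moreover have "automorphism (\<lambda>x y. x \<cdot> e y) (pinv e)"
    using a by (simp add: automorphism_def endomorphism_def inv)
  moreover have "alpha_simple (pinv e) (\<lambda>x y. x \<cdot> e y)"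
    unfolding alpha_simple_def
  proof (intro conjI allI impI q)
    show "bij (pinv e)" using e by (rule bij_imp_bij_inv)
    fix \<theta> assume "normal_congruence (\<lambda>x y. x \<cdot> e y) \<theta> \<and> admissible (pinv e) \<theta>"
    then have n: "equiv UNIV \<theta>" "\<And>x y z. (z \<cdot> e x, z \<cdot> e y) \<in> \<theta> \<longleftrightarrow> (x, y) \<in> \<theta>"
      "\<And>x y z. (x \<cdot> e z, y \<cdot> e z) \<in> \<theta> \<longleftrightarrow> (x, y) \<in> \<theta>"
      and ad: "\<And>x y. (x, y) \<in> \<theta> \<Longrightarrow> (pinv e x, pinv e y) \<in> \<theta> \<and> (e x, e y) \<in> \<theta>"
      unfolding normal_congruence_def congruence_def admissible_def inv_inv_eq[OF e] by blast+
    have "(pinv e x, pinv e y) \<in> \<theta> \<longleftrightarrow> (x, y) \<in> \<theta>" for x y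
      using ad[of x y] ad[of "pinv e x" "pinv e y"] by (auto simp: inv)
    then have "(z \<cdot> x, z \<cdot> y) \<in> \<theta> \<longleftrightarrow> (x, y) \<in> \<theta>" for x y z
      using n(2)[of z "pinv e x" "pinv e y"] by (simp add: inv)
    moreover have "(x \<cdot> z, y \<cdot> z) \<in> \<theta> \<longleftrightarrow> (x, y) \<in> \<theta>" for x y z
      using n(3)[of x "pinv e z" y] by (simp add: inv)
    ultimately have "normal_congruence m \<theta>" by (intro normal_congruenceI n(1))
    then show "\<theta> = Id \<or> \<theta> = UNIV" using s by (simp add: simple_quasigroup_def)
  qed
  ultimately show ?thesis by (simp add: distributive_form_def inv)
qed

text \<open>A distributive quasigroup is idempotent, so \<open>x = d x x = x \<cdot> \<psi>\<inverse> x\<close>.\<close>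

lemma distributive_form_e:
  assumes "distributive_form m d \<psi>"
  shows "e = pinv \<psi>" "d (f x) (\<psi> x) = x" "d x y = x \<cdot> e y"
proof -
  have d: "distributive_quasigroup d" and b: "bij \<psi>" and mx: "\<And>x y. x \<cdot> y = d x (\<psi> y)"
    using assms by (auto simp: distributive_form_def alpha_simple_def)
  have inv: "\<psi> (pinv \<psi> x) = x" for x using b by (simp add: bij_is_surj surj_f_inv_f)
  have idem: "d x x = x" for x
  proof -
    have "d x (d x x) = d (d x x) (d x x)" using d by (simp add: distributive_quasigroup_def)
    then show ?thesis using d unfolding distributive_quasigroup_def quasigroup_def by metis
  qed
  have "e x = pinv \<psi> x" for x
    using e_map_unique[OF quasigroup, of x "pinv \<psi> x"] by (simp add: mx inv idem)
  then show e: "e = pinv \<psi>" by blast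
  show "d (f x) (\<psi> x) = x" using f_left[of x] by (simp add: mx)
  show "d x y = x \<cdot> e y" by (simp add: mx e inv)
qed

text \<open>The operation \<open>d\<close> is \<open>x \<cdot> e y\<close>, so for an \<open>e\<close>-invariant relation compatibility with the two
  operations is the same thing. Without invariance under \<open>e\<inverse>\<close> cancellation on the left of \<open>d\<close> may fail.\<close>

lemma distributive_form_e_simple:
  assumes D: "distributive_form m d \<psi>" and \<theta>: "normal_congruence m \<theta>"
    and e: "\<And>x y. (e x, e y) \<in> \<theta> \<longleftrightarrow> (x, y) \<in> \<theta>"
  shows "\<theta> = Id \<or> \<theta> = UNIV"
proof -
  have b: "bij \<psi>" using D by (simp add: distributive_form_def alpha_simple_def)
  have n: "equiv UNIV \<theta>" "\<And>x y z. (z \<cdot> x, z \<cdot> y) \<in> \<theta> \<longleftrightarrow> (x, y) \<in> \<theta>"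
      "\<And>x y z. (x \<cdot> z, y \<cdot> z) \<in> \<theta> \<longleftrightarrow> (x, y) \<in> \<theta>"
    using \<theta> unfolding normal_congruence_iff by blast+
  have "normal_congruence d \<theta>"
    unfolding normal_congruence_def congruence_def distributive_form_e(3)[OF D] by (simp add: n e)
  moreover have "admissible \<psi> \<theta>"
    unfolding admissible_def
  proof (intro allI impI conjI)
    fix x y assume xy: "(x, y) \<in> \<theta>"
    have "e (\<psi> x) = x" for x using b by (simp add: distributive_form_e(1)[OF D] bij_is_inj)
    then show "(\<psi> x, \<psi> y) \<in> \<theta>" using e[of "\<psi> x" "\<psi> y"] xy by simp
    show "(pinv \<psi> x, pinv \<psi> y) \<in> \<theta>" using e[of x y] xy by (simp add: distributive_form_e(1)[OF D])
  qed
  ultimately show ?thesis using D by (simp add: distributive_form_def alpha_simple_def)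
qed

lemma injective_f_idempotent:
  assumes "inj f" "regular_orbits = Id"
  shows "f = id" "e = id"
proof -
  show "f = id" using regular_orbits_trivial[OF assms(2)] assms(1) by (auto simp: fun_eq_iff inj_eq)
  then show "e = id" using e_id_iff_f_id by blast
qed

lemma transitive_imp_abelian_linear:
  assumes T: "regular_orbits = UNIV"
    and f: "bij f \<or> (simple_quasigroup m \<and> \<not> (\<forall>x y. f x = f y))"
  obtains add zro sub neg \<phi> \<psi> c where "class.ab_group_add add zro sub neg"
    "group_add.linear_over add m \<phi> \<psi> c"
proof -
  obtain add zro sub neg \<phi> \<psi> c where G: "class.group_add sub add zro neg"
    and L: "group_add.linear_over add m \<phi> \<psi> c"
    using transitive_imp_linear[OF T] by metis
  interpret G: group_add sub add zro neg by (rule G)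
  have "add x y = add y x" for x y using G.linear_F_commutative[OF F_quasi_axioms L f] .
  then show thesis using ab_group_add_of_group_add[OF G] L that by blast
qed

text \<open>The orbit congruence is invariant under \<open>e\<close> and therefore subject to the hypothesis. If it is
  trivial then \<open>e = id\<close> and every congruence is \<open>e\<close>-invariant; otherwise the quasigroup is linear over an
  abelian group, because \<open>f\<close> is onto.\<close>

lemma distributive_form_simple:
  assumes e: "bij e" and f: "bij f" and D: "distributive_form m d \<psi>"
  shows "simple_quasigroup m"
proof -
  have "\<theta> = Id \<or> \<theta> = UNIV" if \<theta>: "normal_congruence m \<theta>" for \<theta>
  proof (cases "regular_orbits = Id")
    case True
    then have "e = id" using injective_f_idempotent f by (simp add: bij_is_inj)
    then show ?thesis using distributive_form_e_simple[OF D \<theta>] by simp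
  next
    case False
    then have "regular_orbits = UNIV"
      using distributive_form_e_simple[OF D regular_orbits_normal regular_orbits_e[OF e]] by blast
    then obtain add zro sub neg \<phi> \<psi>' c where G: "class.ab_group_add add zro sub neg"
      and L: "group_add.linear_over add m \<phi> \<psi>' c"
      using transitive_imp_abelian_linear f by metis
    interpret G: ab_group_add add zro sub neg by (rule G)
    show ?thesis
      using G.linear_e_simple_imp_simple[OF F_quasi_axioms L e distributive_form_e_simple[OF D] \<theta>] by blast
  qed
  then show ?thesis using quasigroup by (simp add: simple_quasigroup_def)
qed

text \<open>Injectivity of \<open>f\<close> separates the two outcomes of the orbit dichotomy: idempotent, where the right law
  is right distributivity, or linear over an abelian group.\<close>

lemma simple_distributive:
  assumes s: "simple_quasigroup m" and e: "\<not> zero_endomorphism m e" and f: "\<not> zero_endomorphism m f"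
  shows "bij e \<and> bij f \<and> (\<exists>d \<psi>. distributive_form m d \<psi>)"
proof -
  have "inj f" using simple_endo_cases[OF s endomorphism_f] f by blast
  have "bij e \<and> bij f \<and> (\<forall>x u v. (x \<cdot> e u) \<cdot> e v = (x \<cdot> e v) \<cdot> e (u \<cdot> e v))"
  proof (cases "regular_orbits = Id")
    case True
    then have id: "f = id" "e = id" using injective_f_idempotent \<open>inj f\<close> by blast+
    have "(x \<cdot> u) \<cdot> v = (x \<cdot> v) \<cdot> (u \<cdot> v)" for x u v using right_F[of x u v] by (simp add: id)
    then show ?thesis by (simp add: id)
  next
    case False
    then have "regular_orbits = UNIV"
      using s regular_orbits_normal by (auto simp: simple_quasigroup_def)
    moreover have "\<not> (\<forall>x y. f x = f y)" using f endomorphism_f unfolding zero_endomorphism_def by metis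
    ultimately obtain add zro sub neg \<phi> \<psi>' c where G: "class.ab_group_add add zro sub neg"
      and L: "group_add.linear_over add m \<phi> \<psi>' c"
      using transitive_imp_abelian_linear s by metis
    interpret G: ab_group_add add zro sub neg by (rule G)
    have "(x \<cdot> e u) \<cdot> e v = (x \<cdot> e v) \<cdot> e (u \<cdot> e v)" for x u v
      by (rule G.linear_right_distributive[OF F_quasi_axioms L])
    then show ?thesis using G.linear_e_f_cases[OF F_quasi_axioms L s] e f by simp
  qed
  then show ?thesis using distributive_formI[OF s] by blast
qed

lemma sum_right_form_maps:
  assumes "sum_right_form m add zro \<psi>"
  shows "e x = zro" "add (f x) (\<psi> x) = x"
proof -
  have a: "comm_group (on_UNIV add zro)" "automorphism add \<psi>" and mx: "\<And>x y. x \<cdot> y = add x (\<psi> y)"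
    using assms by (auto simp: sum_right_form_def)
  obtain sub neg where "class.ab_group_add add zro sub neg" using ab_group_add_of_comm_group[OF a(1)] .
  then interpret ab_group_add add zro sub neg .
  have "\<psi> zro = zro" using a(2) additive_map_0 by (simp add: automorphism_def endomorphism_def additive_map_def)
  then show "e x = zro" using e_map_unique[OF quasigroup, of x zro] by (simp add: mx)
  show "add (f x) (\<psi> x) = x" using f_left[of x] by (simp only: mx)
qed

end

theorem theorem3p6:
  fixes m :: "'a \<Rightarrow> 'a \<Rightarrow> 'a"
  assumes "F_quasigroup m"
  shows
    "(simple_quasigroup m \<longleftrightarrow>
        (zero_endomorphism m (e_map m) \<and> zero_endomorphism m (f_map m) \<and> simple_group_on m)
      \<or> (zero_endomorphism m (e_map m) \<and> bij (f_map m) \<and>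
          (\<exists>add zero \<psi>. sum_right_form m add zero \<psi>))
      \<or> (zero_endomorphism m (f_map m) \<and> bij (e_map m) \<and>
          (\<exists>add zero \<phi>. sum_left_form m add zero \<phi>))
      \<or> (bij (e_map m) \<and> bij (f_map m) \<and>
          (\<exists>d \<psi>. distributive_form m d \<psi>)))
   \<and> (\<forall>add zero \<psi>. zero_endomorphism m (e_map m) \<and> bij (f_map m) \<and> sum_right_form m add zero \<psi>
        \<longrightarrow> (\<forall>x. e_map m x = zero \<and> add (f_map m x) (\<psi> x) = x))
   \<and> (\<forall>add zero \<phi>. zero_endomorphism m (f_map m) \<and> bij (e_map m) \<and> sum_left_form m add zero \<phi>
        \<longrightarrow> (\<forall>x. f_map m x = zero \<and> add (\<phi> x) (e_map m x) = x))
   \<and> (\<forall>d \<psi>. bij (e_map m) \<and> bij (f_map m) \<and> distributive_form m d \<psi>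
        \<longrightarrow> e_map m = inv_into UNIV \<psi> \<and> (\<forall>x. d (f_map m x) (\<psi> x) = x))"
proof -
  interpret F_quasi m by (simp add: F_quasi_def assms)
  \<comment> \<open>The opposite operation exchanges the roles of \<open>e\<close> and \<open>f\<close> and turns the second class into the third.\<close>
  interpret D: F_quasi "\<lambda>x y. m y x" by (rule F_quasi_dual)
  note dual = e_map_dual f_map_dual simple_quasigroup_dual[of m] zero_endomorphism_dual[of m]
  have fwd: "(zero_endomorphism m e \<and> zero_endomorphism m f \<and> simple_group_on m)
      \<or> (zero_endomorphism m e \<and> bij f \<and> (\<exists>add zero \<psi>. sum_right_form m add zero \<psi>))
      \<or> (zero_endomorphism m f \<and> bij e \<and> (\<exists>add zero \<phi>. sum_left_form m add zero \<phi>))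
      \<or> (bij e \<and> bij f \<and> (\<exists>d \<psi>. distributive_form m d \<psi>))" if s: "simple_quasigroup m"
  proof (cases "zero_endomorphism m e")
    case e: True
    show ?thesis
    proof (cases "zero_endomorphism m f")
      case True
      then show ?thesis using e s zero_e_f_imp_group by (simp add: simple_group_on_def)
    next
      case False
      then show ?thesis using e simple_sum_right[OF s e] by simp
    qed
  next
    case e: False
    show ?thesis
    proof (cases "zero_endomorphism m f")
      case True
      have "bij e \<and> (\<exists>add zero \<phi>. sum_left_form m add zero \<phi>)"
        using D.simple_sum_right s e True by (simp add: dual sum_left_form_iff_dual[of m])
      then show ?thesis using True by simp
    next
      case False
      then show ?thesis using simple_distributive[OF s e] by simp
    qed
  qed
  have bwd: "simple_quasigroup m" if "simple_group_on m \<or> (\<exists>add zero \<psi>. sum_right_form m add zero \<psi>) 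
    \<or> (\<exists>add zero \<phi>. sum_left_form m add zero \<phi>) \<or> (bij e \<and> bij f \<and> (\<exists>d \<psi>. distributive_form m d \<psi>))"
    using that
  proof (elim disjE exE conjE)
    fix add zero \<psi> assume "sum_left_form m add zero \<psi>"
    then show "simple_quasigroup m"
      using sum_right_form_simple[OF D.quasigroup] by (simp add: sum_left_form_iff_dual[of m] dual)
  qed (auto simp: simple_group_on_def intro: sum_right_form_simple[OF quasigroup] distributive_form_simple)
  have right: "\<forall>x. e x = zero \<and> add (f x) (\<psi> x) = x" if "sum_right_form m add zero \<psi>" for add zero \<psi>
    using sum_right_form_maps[OF that] by simp
  have left: "\<forall>x. f x = zero \<and> add (\<phi> x) (e x) = x" if L: "sum_left_form m add zero \<phi>" for add zero \<phi>
  proof -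
    have "f x = zero" for x
      using D.sum_right_form_maps(1)[of add zero \<phi> x] L by (simp add: sum_left_form_iff_dual[of m] dual)
    moreover have "add (\<phi> x) (e x) = x" for x
    proof -
      have "m x (e x) = add (\<phi> x) (e x)" using L by (simp only: sum_left_form_def)
      then show ?thesis by simp
    qed
    ultimately show ?thesis by blast
  qed
  have dist: "e = pinv \<psi> \<and> (\<forall>x. d (f x) (\<psi> x) = x)" if "distributive_form m d \<psi>" for d \<psi>
    using distributive_form_e[OF that] by simp
  show ?thesis using fwd bwd right left dist by blast
qed

end
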